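(* Let $$b_a=\frac{\frac{\partial}{\partial y}\zeta(6,iy)}{\frac{\partial}{\partial y}\zeta(3,iy)}\Big|_{y=1}=4.0774\cdots.$$ Then $\min_{z\in\Gamma_a}\big(\zeta(6,z)-b\zeta(3,z)\big)$ is achieved at $z=i$ if $b\le b_a$, and at $z=iy_b$ with $y_b>1$ if $b>b_a$. Moreover $\frac{dy_b}{db}>0$ and $\lim_{b\to\infty}\frac{y_b}{\sqrt[3]{\frac{\xi(6)}{2\xi(12)}\,b}}=1$.
   Context: For $s>1$ and $z$ with $\Im z>0$, $\zeta(s,z)=\sum_{(m,n)\in\mathbb{Z}^2\setminus\{0\}}\frac{(\Im z)^s}{|mz+n|^{2s}}$; $\xi$ is the Riemann zeta function. $\Gamma_a=\{z:\Re z=0,\ \Im z\ge1\}$. At $y=1$ both $\frac{\partial}{\partial y}\zeta(6,iy)$ and $\frac{\partial}{\partial y}\zeta(3,iy)$ vanish; the quotient defining $b_a$ is understood as its limiting value at $y=1$. *)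

theory Defs
  imports "HOL-Analysis.Analysis"
begin

definition epstein_zeta :: "real \<Rightarrow> complex \<Rightarrow> real" where
  "epstein_zeta s z =
     infsum (\<lambda>(m::int, n::int). (Im z) powr s / (cmod (of_int m * z + of_int n)) powr (2 * s))
            (UNIV - {(0, 0)})"

definition riemann_zeta_real :: "real \<Rightarrow> real" where
  "riemann_zeta_real s = (\<Sum>n. 1 / (real (Suc n)) powr s)"

definition Gamma_a :: "complex set" where
  "Gamma_a = {z. Re z = 0 \<and> Im z \<ge> 1}"

definition b_a :: real where
  "b_a = Lim (at 1) (\<lambda>y. deriv (\<lambda>t. epstein_zeta 6 (\<i> * of_real t)) y
                        / deriv (\<lambda>t. epstein_zeta 3 (\<i> * of_real t)) y)"

end

theory Submission
  imports Defs "HOL-Real_Asymp.Real_Asymp"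
begin

text \<open>
  The zeta function on the imaginary axis is invariant under \<open>y \<mapsto> 1 / y\<close>, so it is a function
  \<open>G\<^sub>s\<close> of \<open>u = (y + 1 / y) / 2 \<ge> 1\<close>. Splitting off the points on the coordinate axes,
  \<open>G\<^sub>s(u) = 4 \<xi>(2s) T\<^sub>s(u) + 2 H\<^sub>s(u)\<close> with the Chebyshev polynomial \<open>T\<^sub>s\<close> and a series \<open>H\<^sub>s\<close> of rational
  functions of \<open>u\<close> over the positive quadrant, which is small together with its derivatives. In the
  variable \<open>u\<close> the point \<open>y = 1\<close> is no longer critical: \<open>G\<^sub>3' > 0\<close> on \<open>[1, \<infinity>)\<close>, the quotient of
  \<open>y\<close>-derivatives is \<open>Q(u) = G\<^sub>6'(u) / G\<^sub>3'(u)\<close>, and \<open>b\<^sub>a = Q(1)\<close>. Crude bounds on \<open>H\<^sub>s\<close> already give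
  \<open>G\<^sub>6'' G\<^sub>3' - G\<^sub>6' G\<^sub>3'' > 0\<close>, so \<open>Q\<close> is increasing, and \<open>G\<^sub>6' - b G\<^sub>3' = G\<^sub>3' (Q - b)\<close> has the sign pattern
  that locates the minimum at \<open>u = 1\<close> or at the unique solution of \<open>Q(u) = b\<close>. The asymptotics follow
  from \<open>Q(u) \<sim> 16 \<xi>(12) / \<xi>(6) u\<^sup>3\<close> and \<open>y \<sim> 2 u\<close>.
\<close>

section \<open>Bounds on the off-axis terms\<close>

text \<open>For a lattice point \<open>(m, n)\<close> put \<open>A = m\<^sup>2 y + n\<^sup>2 / y\<close> and
  \<open>B = n\<^sup>2 y + m\<^sup>2 / y\<close>. With \<open>q = m\<^sup>2 + n\<^sup>2\<close> and \<open>a = 4 m\<^sup>2 n\<^sup>2\<close> one has \<open>A + B = 2 q u\<close> and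
  \<open>A B = pden q a u\<close>, so that \<open>P3\<close> and \<open>P6\<close> are \<open>A\<^sup>-\<^sup>3 + B\<^sup>-\<^sup>3\<close> and \<open>A\<^sup>-\<^sup>6 + B\<^sup>-\<^sup>6\<close>. All bounds come from
  \<open>q\<^sup>2 \<le> pden q a u\<close> and \<open>0 \<le> a u\<^sup>2 / pden q a u \<le> 1\<close>.\<close>

definition pden :: "real \<Rightarrow> real \<Rightarrow> real \<Rightarrow> real" where
  "pden q a u = q\<^sup>2 + a * (u\<^sup>2 - 1)"

definition P3 :: "real \<Rightarrow> real \<Rightarrow> real \<Rightarrow> real" where
  "P3 q a u = 8 * q^3 * u^3 / pden q a u ^ 3 - 6 * q * u / pden q a u ^ 2"

definition P6 :: "real \<Rightarrow> real \<Rightarrow> real \<Rightarrow> real" where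
  "P6 q a u = (P3 q a u)\<^sup>2 - 2 / pden q a u ^ 3"

text \<open>Both derivatives are arranged as prefactors times polynomials in
  \<open>w = a * u\<^sup>2 / pden q a u\<close>. Since \<open>w\<close> lies in [0, 1], each
  estimate below reduces to a polynomial on the unit interval.\<close>

definition dP3 :: "real \<Rightarrow> real \<Rightarrow> real \<Rightarrow> real" where
  "dP3 q a u = 24 * q^3 * u\<^sup>2 / pden q a u ^ 3 * (1 - 2 * (a * u\<^sup>2 / pden q a u))
     - 6 * q / pden q a u ^ 2 * (1 - 4 * (a * u\<^sup>2 / pden q a u))"

definition ddP3 :: "real \<Rightarrow> real \<Rightarrow> real \<Rightarrow> real" where
  "ddP3 q a u = 24 * q^3 * u / pden q a u ^ 3
       * (2 - 14 * (a * u\<^sup>2 / pden q a u) + 16 * (a * u\<^sup>2 / pden q a u)\<^sup>2)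
     + 72 * q * a * u / pden q a u ^ 3 * (1 - 2 * (a * u\<^sup>2 / pden q a u))"

definition dP6 :: "real \<Rightarrow> real \<Rightarrow> real \<Rightarrow> real" where
  "dP6 q a u = 2 * P3 q a u * dP3 q a u + 12 * a * u / pden q a u ^ 4"

definition ddP6 :: "real \<Rightarrow> real \<Rightarrow> real \<Rightarrow> real" where
  "ddP6 q a u = 2 * (dP3 q a u)\<^sup>2 + 2 * P3 q a u * ddP3 q a u
     + 12 * a / pden q a u ^ 4 * (1 - 8 * (a * u\<^sup>2 / pden q a u))"

lemma pden_deriv: "(pden q a has_real_derivative 2 * a * u) (at u)"
  unfolding pden_def[abs_def] by (auto intro!: derivative_eq_intros)

context
  fixes q a u :: real
  assumes q: "0 < q" and a: "0 < a" "a \<le> q\<^sup>2" and u: "1 \<le> u"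
begin

lemma one_le_u_squared: "1 \<le> u\<^sup>2" using u by simp

lemma pden_ge: "q\<^sup>2 \<le> pden q a u"
  using one_le_u_squared a unfolding pden_def by simp

lemma pden_ge_au: "a * u\<^sup>2 \<le> pden q a u"
  using a unfolding pden_def by (simp add: algebra_simps)

lemma pden_le: "pden q a u \<le> q\<^sup>2 * u\<^sup>2"
proof -
  have "a * (u\<^sup>2 - 1) \<le> q\<^sup>2 * (u\<^sup>2 - 1)"
    using a one_le_u_squared by (intro mult_right_mono) auto
  thus ?thesis unfolding pden_def by (simp add: algebra_simps)
qed

lemma pden_pos: "0 < pden q a u"
  using pden_ge q by (smt (verit) zero_less_power)

lemma pden_w: "0 \<le> a * u\<^sup>2 / pden q a u" "a * u\<^sup>2 / pden q a u \<le> 1"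
  using pden_pos pden_ge_au a by auto

lemma pden_power_ge: "q ^ (2 * k) \<le> pden q a u ^ k"
  unfolding power_mult using pden_ge by (intro power_mono) auto

lemma P3_deriv: "(P3 q a has_real_derivative dP3 q a u) (at u)"
  unfolding P3_def[abs_def] dP3_def
  by (insert pden_pos u,
      (rule derivative_eq_intros pden_deriv refl | (simp; fail))+,
      simp add: field_simps eval_nat_numeral)

lemma dP3_deriv: "(dP3 q a has_real_derivative ddP3 q a u) (at u)"
  unfolding dP3_def[abs_def] ddP3_def
  by (insert pden_pos u,
      (rule derivative_eq_intros pden_deriv refl | (simp; fail))+,
      simp add: field_simps eval_nat_numeral)

lemma P6_deriv: "(P6 q a has_real_derivative dP6 q a u) (at u)"
  unfolding P6_def[abs_def] dP6_def
  by (insert pden_pos u,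
      (rule derivative_eq_intros pden_deriv P3_deriv refl | (simp; fail))+,
      simp add: field_simps eval_nat_numeral)

lemma dP6_deriv: "(dP6 q a has_real_derivative ddP6 q a u) (at u)"
  unfolding dP6_def[abs_def] ddP6_def
  by (insert pden_pos u,
      (rule derivative_eq_intros pden_deriv P3_deriv dP3_deriv refl | (simp; fail))+,
      simp add: field_simps eval_nat_numeral)

text \<open>Trades powers of \<open>pden\<close> for powers of \<open>q\<close>, which makes the
  later bounds uniform in \<open>a\<close> and summable over the quadrant.\<close>

lemma inv_pden:
  "q ^ 3 / pden q a u ^ 3 \<le> 1 / q ^ 3" "q / pden q a u ^ 2 \<le> 1 / q ^ 3"
  "1 / pden q a u ^ 3 \<le> 1 / q ^ 6"
  using pden_power_ge[of 3] pden_power_ge[of 2] pden_pos q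
  by (auto simp: divide_simps power_add[symmetric] mult.commute power_Suc[symmetric] simp del: power_Suc)

text \<open>The factor \<open>q^3 / pden q a u ^ 3\<close> is left in place because two different
  lower bounds for \<open>pden\<close> are inserted later: one gives good constants, the other
  slower growth in \<open>u\<close>.\<close>

lemma abs_dP3_le_pden: "\<bar>dP3 q a u\<bar> \<le> 24 * u\<^sup>2 * (q^3 / pden q a u ^ 3) + 18 / q^3"
proof -
  define w where "w = a * u\<^sup>2 / pden q a u"
  have w: "\<bar>1 - 2 * w\<bar> \<le> 1" "\<bar>1 - 4 * w\<bar> \<le> 3"
    using pden_w unfolding w_def[symmetric] by linarith+
  have "\<bar>dP3 q a u\<bar>
      \<le> \<bar>24 * q^3 * u\<^sup>2 / pden q a u ^ 3 * (1 - 2 * w)\<bar> + \<bar>6 * q / pden q a u ^ 2 * (1 - 4 * w)\<bar>"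
    unfolding dP3_def w_def by (rule abs_triangle_ineq4)
  also have "\<bar>24 * q^3 * u\<^sup>2 / pden q a u ^ 3 * (1 - 2 * w)\<bar>
      \<le> 24 * q^3 * u\<^sup>2 / pden q a u ^ 3 * 1"
    using w pden_pos q unfolding abs_mult[of _ "1 - _"] by (intro mult_mono) auto
  also have "\<bar>6 * q / pden q a u ^ 2 * (1 - 4 * w)\<bar> \<le> 6 * q / pden q a u ^ 2 * 3"
    using w pden_pos q unfolding abs_mult[of _ "1 - _"] by (intro mult_mono) auto
  finally show ?thesis using mult_left_mono[OF inv_pden(2), of 18] by (simp add: mult_ac)
qed

lemma abs_dP3_le: "\<bar>dP3 q a u\<bar> \<le> (24 * u\<^sup>2 + 18) * (1 / q^3)"
proof -
  have "24 * u\<^sup>2 * (q^3 / pden q a u ^ 3) \<le> 24 * u\<^sup>2 * (1 / q^3)"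
    by (intro mult_left_mono inv_pden) auto
  thus ?thesis using abs_dP3_le_pden by (simp add: algebra_simps)
qed

text \<open>Growth of order \<open>u^2\<close> would compete with the main term of
  \<open>dG3\<close> at infinity. For \<open>a >= 4\<close> the product of the two lower bounds
  \<open>q^2\<close> and \<open>a * u^2\<close> of \<open>pden\<close> gives
  \<open>pden >= 2 * q * u\<close>, which saves one power of \<open>u\<close> at the cost of one
  power of \<open>1 / q\<close>.\<close>

lemma abs_dP3_le_linear:
  assumes a4: "4 \<le> a"
  shows "\<bar>dP3 q a u\<bar> \<le> 12 * u * (1 / q^2) + 18 * (1 / q^3)"
proof -
  have "(2 * q * u)\<^sup>2 \<le> q\<^sup>2 * (a * u\<^sup>2)"
    using mult_mono[OF a4 order_refl, of "q\<^sup>2 * u\<^sup>2"] a by (simp add: power_mult_distrib mult_ac)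
  also have "\<dots> \<le> pden q a u * pden q a u"
    using pden_ge pden_ge_au a pden_pos by (intro mult_mono) auto
  finally have "(2 * q * u)\<^sup>2 \<le> (pden q a u)\<^sup>2"
    by (simp only: power2_eq_square[of "pden q a u"])
  hence p: "2 * q * u \<le> pden q a u"
    by (rule power2_le_imp_le) (use pden_pos in simp)
  have "q^4 * (2 * q * u) \<le> pden q a u ^ 2 * pden q a u"
    using p pden_power_ge[of 2] q u by (intro mult_mono) auto
  hence "q^3 * u\<^sup>2 / pden q a u ^ 3 \<le> q^3 * u\<^sup>2 / (q^4 * (2 * q * u))"
    using q u by (intro divide_left_mono) (auto simp: power3_eq_cube power2_eq_square pden_pos)
  also have "\<dots> = u / (2 * q\<^sup>2)" using q u by (simp add: field_simps eval_nat_numeral)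
  finally have "q^3 * u\<^sup>2 / pden q a u ^ 3 \<le> u / (2 * q\<^sup>2)" .
  moreover have "24 * u\<^sup>2 * (q^3 / pden q a u ^ 3) = 24 * (q^3 * u\<^sup>2 / pden q a u ^ 3)"
    "12 * u * (1 / q^2) = 24 * (u / (2 * q\<^sup>2))" "18 / q^3 = 18 * (1 / q^3)"
      by (simp_all add: mult_ac)
  ultimately show ?thesis using abs_dP3_le_pden by linarith
qed

lemma abs_ddP3_le: "\<bar>ddP3 q a u\<bar> \<le> (96 * u + 72 / u) * (1 / q^3)"
proof -
  define w where "w = a * u\<^sup>2 / pden q a u"
  have w: "0 \<le> w" "w \<le> 1" using pden_w by (auto simp: w_def)
  \<comment> \<open>One factor \<open>a * u^2 / pden\<close> is absorbed into \<open>w\<close>, so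
    that \<open>a\<close> disappears and a gain of \<open>1 / u^2\<close> becomes visible.\<close>
  have e: "72 * q * a * u / pden q a u ^ 3 * (1 - 2 * w) = 72 / u * (q / pden q a u ^ 2) * (w * (1 - 2 * w))"
    using pden_pos u unfolding w_def by (simp add: field_simps eval_nat_numeral)
  \<comment> \<open>Completing the square shows that the minimum is -17/16. The maximum 4 on [0, 1]
    comes from \<open>w^2 <= w\<close>, which bounds the polynomial by
    \<open>2 + 2 * w\<close>.\<close>
  have "2 - 14 * w + 16 * w\<^sup>2 = 16 * (w - 7/16)\<^sup>2 - 17/16"
    by (simp add: power2_eq_square algebra_simps)
  hence l: "-4 \<le> 2 - 14 * w + 16 * w\<^sup>2" using zero_le_power2[of "w-7/16"] by linarith
  have "w\<^sup>2 \<le> w" using w by (simp add: power2_eq_square mult_left_le)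
  hence 1: "\<bar>2 - 14 * w + 16 * w\<^sup>2\<bar> \<le> 4" using l w by linarith
  have 2: "\<bar>w * (1 - 2 * w)\<bar> \<le> 1 * 1"
    unfolding abs_mult using w by (intro mult_mono) auto
  have "\<bar>ddP3 q a u\<bar>
      \<le> \<bar>24 * u * (q^3 / pden q a u ^ 3) * (2 - 14 * w + 16 * w\<^sup>2)\<bar>
      + \<bar>72 / u * (q / pden q a u ^ 2) * (w * (1 - 2 * w))\<bar>"
    using abs_triangle_ineq[of "24 * q^3 * u / pden q a u ^ 3 * (2 - 14 * w + 16 * w\<^sup>2)"
        "72 / u * (q / pden q a u ^ 2) * (w * (1 - 2 * w))"]
    unfolding ddP3_def w_def[symmetric] e by (simp only: mult_ac times_divide_eq_left times_divide_eq_right)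
  also have "\<bar>24 * u * (q^3 / pden q a u ^ 3) * (2 - 14 * w + 16 * w\<^sup>2)\<bar>
      \<le> 24 * u * (1 / q^3) * 4"
    unfolding abs_mult[of "24 * u * _"] using 1 mult_left_mono[OF inv_pden(1), of "24 * u"] q u pden_pos by (intro mult_mono) (auto simp: abs_mult)
  also have "\<bar>72 / u * (q / pden q a u ^ 2) * (w * (1 - 2 * w))\<bar> \<le> 72 / u * (1 / q^3) * 1"
    unfolding abs_mult[of "72 / u * _"] using 2 mult_left_mono[OF inv_pden(2), of "72 / u"] q u pden_pos by (intro mult_mono) (auto simp: abs_mult)
  finally show ?thesis by (simp add: algebra_simps)
qed

text \<open>By \<open>pden <= q^2 * u^2\<close> the subtracted term is at most 6/8 of the leading
  one, so the difference is nonnegative; the upper bound just drops the subtracted term.\<close>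

lemma P3_bounds: "0 \<le> P3 q a u" "P3 q a u \<le> 8 * u^3 * (1 / q^3)"
proof -
  have "q * u / pden q a u ^ 2 * pden q a u \<le> q * u / pden q a u ^ 2 * (q\<^sup>2 * u\<^sup>2)"
    using pden_le q u by (intro mult_left_mono) auto
  hence "q * u / pden q a u ^ 2 \<le> q^3 * u^3 / pden q a u ^ 3"
    using pden_pos by (simp add: field_simps eval_nat_numeral)
  moreover have "0 \<le> q * u / pden q a u ^ 2" using q u by simp
  ultimately show "0 \<le> P3 q a u" unfolding P3_def by (simp add: mult.assoc)
  have "u^3 * (q^3 / pden q a u ^ 3) \<le> u^3 * (1 / q^3)"
    using u by (intro mult_left_mono inv_pden) auto
  moreover have "P3 q a u = 8 * (u^3 * (q^3 / pden q a u ^ 3)) - 6 * (q * u / pden q a u ^ 2)"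
    unfolding P3_def by (simp add: mult_ac)
  ultimately show "P3 q a u \<le> 8 * u^3 * (1 / q^3)"
    using \<open>0 \<le> q * u / pden q a u ^ 2\<close> by linarith
qed

text \<open>\<open>dP3\<close> is kept unestimated so that either its quadratic or its linear bound
  in \<open>u\<close> can be inserted.\<close>

lemma abs_dP6_le_dP3: "\<bar>dP6 q a u\<bar>
    \<le> 16 * u^3 * (1 / q^3) * \<bar>dP3 q a u\<bar> + 12 * (1 / q^6)"
proof -
  have e: "12 * a * u / pden q a u ^ 4 = 12 * (1 / u * (a * u\<^sup>2 / pden q a u)) * (1 / pden q a u ^ 3)"
    using pden_pos u by (simp add: field_simps eval_nat_numeral)
  have "1 / u * (a * u\<^sup>2 / pden q a u) \<le> 1 * 1" using u pden_w by (intro mult_mono) auto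
  hence "12 * (1 / u * (a * u\<^sup>2 / pden q a u)) * (1 / pden q a u ^ 3) \<le> 12 * (1 / q^6)"
    using inv_pden(3) pden_pos q by (intro mult_mono) auto
  moreover have "0 \<le> 12 * a * u / pden q a u ^ 4" using a u by simp
  moreover have "\<bar>2 * P3 q a u * dP3 q a u\<bar> \<le> 16 * u^3 * (1 / q^3) * \<bar>dP3 q a u\<bar>"
    unfolding abs_mult using P3_bounds by (intro mult_right_mono) auto
  ultimately show ?thesis unfolding dP6_def e by linarith
qed

lemma abs_dP6_le: "\<bar>dP6 q a u\<bar> \<le> (384 * u^5 + 288 * u^3 + 12) * (1 / q^6)"
proof -
  have "16 * u^3 * (1 / q^3) * \<bar>dP3 q a u\<bar>
      \<le> 16 * u^3 * (1 / q^3) * ((24 * u\<^sup>2 + 18) * (1 / q^3))"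
    using abs_dP3_le u q by (intro mult_left_mono) auto
  also have "\<dots> = (384 * u^5 + 288 * u^3) * (1 / q^6)"
    by (simp add: field_simps power_add[symmetric])
  finally show ?thesis using abs_dP6_le_dP3 by (simp add: algebra_simps)
qed

lemma P3_ddP3_le: "\<bar>2 * P3 q a u * ddP3 q a u\<bar> \<le> (1536 * u^4 + 1152 * u\<^sup>2) * (1 / q^6)"
proof -
  have "\<bar>2 * P3 q a u * ddP3 q a u\<bar> \<le> (16 * u^3 * (1 / q^3)) * ((96 * u + 72 / u) * (1 / q^3))"
    unfolding abs_mult[of "2 * _"] using P3_bounds abs_ddP3_le u q
    by (intro mult_mono[of "\<bar>2 * P3 q a u\<bar>"]) auto
  also have "\<dots> = (1536 * u^4 + 1152 * u\<^sup>2) * (1 / q^6)"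
    using u q by (simp add: field_simps eval_nat_numeral)
  finally show ?thesis .
qed

lemma ddP6_last_le: "\<bar>12 * a / pden q a u ^ 4 * (1 - 8 * (a * u\<^sup>2 / pden q a u))\<bar>
    \<le> 84 * (1 / q^6)"
proof -
  define w where "w = a * u\<^sup>2 / pden q a u"
  have w: "\<bar>1 - 8 * w\<bar> \<le> 7" using pden_w unfolding w_def[symmetric] by linarith
  have "a / pden q a u \<le> 1" using a pden_ge pden_pos by (simp add: divide_simps)
  hence "12 * (a / pden q a u) * (1 / pden q a u ^ 3) * \<bar>1 - 8 * w\<bar> \<le> 12 * 1 * (1 / q^6) * 7"
    using inv_pden(3) w pden_pos a q by (intro mult_mono) auto
  thus ?thesis unfolding w_def[symmetric] using pden_pos a by (simp add: abs_mult eval_nat_numeral)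
qed

text \<open>Only a lower bound enters the Wronskian estimate, so the nonnegative square of
  \<open>dP3\<close> is dropped; this gives far better constants than the two-sided bound, which
  serves only for domination.\<close>

lemma ddP6_ge: "- (1536 * u^4 + 1152 * u\<^sup>2 + 84) * (1 / q^6) \<le> ddP6 q a u"
  using ddP6_last_le P3_ddP3_le zero_le_power2[of "dP3 q a u"]
  unfolding ddP6_def minus_add_distrib distrib_right by linarith

lemma abs_ddP6_le:
  "\<bar>ddP6 q a u\<bar>
      \<le> (2 * (24 * u\<^sup>2 + 18)\<^sup>2 + 1536 * u^4 + 1152 * u\<^sup>2 + 84) * (1 / q^6)"
proof -
  have "(dP3 q a u)\<^sup>2 \<le> ((24 * u\<^sup>2 + 18) * (1 / q^3))\<^sup>2"
    using abs_dP3_le by (metis abs_ge_zero power2_abs power_mono)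
  also have "\<dots> = (24 * u\<^sup>2 + 18)\<^sup>2 * (1 / q^6)"
    by (simp add: power_mult_distrib power_divide power_mult[symmetric])
  finally show ?thesis using ddP6_last_le P3_ddP3_le zero_le_power2[of "dP3 q a u"]
    unfolding ddP6_def distrib_right by linarith
qed

end

section \<open>Summation over the positive quadrant\<close>

lemma has_sum_product_nonneg:
  fixes f :: "'a \<Rightarrow> real" and g :: "'b \<Rightarrow> real"
  assumes "(f has_sum F) A" "(g has_sum G) B"
    and "\<And>x. x \<in> A \<Longrightarrow> 0 \<le> f x" "\<And>y. y \<in> B \<Longrightarrow> 0 \<le> g y"
  shows "((\<lambda>(x, y). f x * g y) has_sum F * G) (A \<times> B)"
proof (rule has_sum_SigmaI)
  show 1: "((\<lambda>y. case (x, y) of (x, y) \<Rightarrow> f x * g y) has_sum f x * G) B" for x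
    using has_sum_cmult_right[OF assms(2), of "f x"] by simp
  show 2: "((\<lambda>x. f x * G) has_sum F * G) A" by (intro has_sum_cmult_left assms)
  show "(\<lambda>(x, y). f x * g y) summable_on A \<times> B"
    by (rule summable_on_SigmaI[OF 1]) (use 2 assms in \<open>auto simp: summable_on_def\<close>)
qed

section \<open>Telescoping bounds for zeta values at integers\<close>

lemma inverse_power_telescope:
  assumes "n \<ge> 1" "k \<ge> 1"
  shows "1 / real (Suc n) ^ Suc k \<le> 1 / (k * real n ^ k) - 1 / (k * real (Suc n) ^ k)"
proof -
  \<comment> \<open>Bernoulli's inequality replaces the comparison of the sum with the integral of
    \<open>x^-(k+1)\<close>.\<close>
  have "1 + real k * (1 / n) \<le> (1 + 1 / n) ^ k"
    by (rule Bernoulli_inequality) (auto intro: order_trans[of _ 0])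
  also have "1 + 1 / real n = real (Suc n) / n" using assms by (simp add: field_simps)
  finally have "real n ^ k * (1 + real k / n) \<le> real (Suc n) ^ k"
    using assms by (simp add: power_divide field_simps)
  hence "1 + real k / n \<le> real (Suc n) ^ k / real n ^ k"
    using assms by (simp add: field_simps)
  moreover have "real k / Suc n \<le> real k / n" using assms by (intro divide_left_mono) auto
  ultimately have "real k / Suc n / real (Suc n) ^ k
      \<le> (real (Suc n) ^ k / real n ^ k - 1) / real (Suc n) ^ k"
    by (intro divide_right_mono) auto
  also have "\<dots> = 1 / real n ^ k - 1 / real (Suc n) ^ k" by (simp add: diff_divide_distrib)
  finally have "(1 / real k) * (real k / Suc n / real (Suc n) ^ k)
      \<le> (1 / real k) * (1 / real n ^ k - 1 / real (Suc n) ^ k)"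
    by (intro mult_left_mono) auto
  thus ?thesis using assms by (simp add: right_diff_distrib)
qed

lemma inverse_power_sums:
  assumes "k \<ge> 1"
  shows "summable (\<lambda>n. 1 / real (Suc n) ^ Suc k)"
proof -
  have "summable (\<lambda>n. inverse (real n ^ Suc k))"
    using assms by (intro inverse_power_summable) auto
  thus ?thesis by (subst (asm) summable_Suc_iff[symmetric]) (simp add: inverse_eq_divide)
qed

lemma inverse_power_tail:
  assumes "N \<ge> 1" "k \<ge> 1"
  shows "(\<Sum>n. 1 / real (Suc (n + N)) ^ Suc k) \<le> 1 / (k * real N ^ k)"
proof -
  have "(\<lambda>n. 1 / (k * real (n + N) ^ k)) \<longlonglongrightarrow> 0"
  proof -
    have "filterlim (\<lambda>n. real (n + N)) at_top sequentially"
      by (intro filterlim_compose[OF filterlim_real_sequentially] filterlim_add_const_nat_at_top)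
    hence "filterlim (\<lambda>n. k * real (n + N) ^ k) at_top sequentially"
      using assms by (intro filterlim_tendsto_pos_mult_at_top[OF tendsto_const] filterlim_pow_at_top) auto
    thus ?thesis by (intro tendsto_divide_0[OF tendsto_const]) (auto intro: filterlim_at_top_imp_at_infinity)
  qed
  from telescope_sums'[OF this]
  have s: "(\<lambda>n. 1 / (k * real (n + N) ^ k) - 1 / (k * real (Suc (n + N)) ^ k)) sums (1 / (k * real N ^ k))"
    by simp
  have "summable (\<lambda>n. 1 / real (Suc (n + N)) ^ Suc k)"
    using summable_iff_shift[of "\<lambda>n. 1 / real (Suc n) ^ Suc k" N] inverse_power_sums[OF assms(2)] by simp
  thus ?thesis using s assms
    by (intro order_trans[OF suminf_le[OF inverse_power_telescope]]) (auto simp: sums_iff)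
qed

text \<open>Natural exponents keep \<open>powr\<close> out of the estimates; the values agree with
  \<open>riemann_zeta_real\<close> at numerals.\<close>

definition zeta_nat :: "nat \<Rightarrow> real" where "zeta_nat k = (\<Sum>n. 1 / real (Suc n) ^ k)"

lemma zeta_nat_has_sum: "k \<ge> 2 \<Longrightarrow> ((\<lambda>n. 1 / real (Suc n) ^ k)
    has_sum zeta_nat k) UNIV"
  unfolding zeta_nat_def using inverse_power_sums[of "k - 1"]
  by (intro sums_nonneg_imp_has_sum summable_sums) auto

lemma zeta_nat_bounds:
  assumes "N \<ge> 1" "k \<ge> 1"
  shows "(\<Sum>n<N. 1 / real (Suc n) ^ Suc k) \<le> zeta_nat (Suc k)"
    "zeta_nat (Suc k) \<le> (\<Sum>n<N. 1 / real (Suc n) ^ Suc k) + 1 / (k * real N ^ k)"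
proof -
  note s = inverse_power_sums[OF assms(2)]
  show "(\<Sum>n<N. 1 / real (Suc n) ^ Suc k) \<le> zeta_nat (Suc k)"
    unfolding zeta_nat_def by (intro sum_le_suminf s) auto
  show "zeta_nat (Suc k) \<le> (\<Sum>n<N. 1 / real (Suc n) ^ Suc k) + 1 / (k * real N ^ k)"
    unfolding zeta_nat_def suminf_split_initial_segment[OF s, of N] using inverse_power_tail[OF assms] by simp
qed

lemma riemann_zeta_real_eq: "riemann_zeta_real (numeral k) = zeta_nat (numeral k)"
  unfolding riemann_zeta_real_def zeta_nat_def by (simp add: powr_realpow flip: of_nat_Suc)

text \<open>Termwise differentiation for sums over pairs: enumerating the pairs by
  \<open>prod_decode\<close> turns the sum into an ordinary series, to which the Weierstrass M-test
  and the differentiation theorem for series apply.\<close>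

lemma has_field_derivative_infsum:
  fixes f f' :: "nat \<times> nat \<Rightarrow> real \<Rightarrow> real"
  assumes S: "convex S"
    and D: "\<And>i x. x \<in> S \<Longrightarrow> (f i has_field_derivative f' i x) (at x within S)"
    and M: "\<And>i x. x \<in> S \<Longrightarrow> \<bar>f' i x\<bar> \<le> M i" "M summable_on UNIV"
    and f: "\<And>x. x \<in> S \<Longrightarrow> (\<lambda>i. f i x) summable_on UNIV"
    and x: "x \<in> S"
  shows "((\<lambda>x. \<Sum>\<^sub>\<infinity>i. f i x) has_field_derivative (\<Sum>\<^sub>\<infinity>i. f' i x)) (at x within S)"
proof -
  let ?d = prod_decode
  have reix: "(\<lambda>n. g (?d n)) sums infsum g UNIV" if "g summable_on UNIV"
    for g :: "nat \<times> nat \<Rightarrow> real"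
    by (rule has_sum_imp_sums) (subst has_sum_reindex_bij_betw[OF bij_prod_decode], use that in simp)
  have f': "(\<lambda>i. f' i y) summable_on UNIV" if "y \<in> S" for y
    by (rule abs_summable_summable, rule summable_on_comparison_test[OF M(2)]) (use M that in auto)
  have "uniform_limit S (\<lambda>n x. \<Sum>i<n. f' (?d i) x) (\<lambda>x. suminf (\<lambda>n. f' (?d n) x)) sequentially"
    by (rule Weierstrass_m_test[where M = "\<lambda>n. M (?d n)"]) (use M reix[OF M(2)] in \<open>auto simp: sums_iff\<close>)
  also have "?this \<longleftrightarrow> uniform_limit S (\<lambda>n x. \<Sum>i<n. f' (?d i) x) (\<lambda>x. infsum (\<lambda>i. f' i x) UNIV) sequentially"
    by (intro uniform_limit_cong') (use reix f' in \<open>auto simp: sums_iff\<close>)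
  finally obtain g where g: "\<forall>x\<in>S. (\<lambda>n. f (?d n) x) sums g x
      \<and> (g has_field_derivative infsum (\<lambda>i. f' i x) UNIV) (at x within S)"
    using has_field_derivative_series[OF S D _ x sums_summable[OF reix[OF f[OF x]]]] by blast
  have "g y = infsum (\<lambda>i. f i y) UNIV" if "y \<in> S" for y
    using reix[OF f[OF that]] g that by (metis sums_unique2)
  moreover have "(g has_field_derivative infsum (\<lambda>i. f' i x) UNIV) (at x within S)"
    using g x by blast
  ultimately show ?thesis using has_field_derivative_transform_within[OF _ zero_less_one x] by simp
qed

text \<open>The shift by \<open>Suc\<close> makes all of \<open>nat \<times> nat\<close> enumerate
  the lattice points with both coordinates at least 1; \<open>qf\<close> and \<open>af\<close> are
  their parameters \<open>q\<close> and \<open>a\<close>.\<close>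

definition qf :: "nat \<times> nat \<Rightarrow> real" where
  "qf i = (real (Suc (fst i)))\<^sup>2 + (real (Suc (snd i)))\<^sup>2"

definition af :: "nat \<times> nat \<Rightarrow> real" where
  "af i = 4 * (real (Suc (fst i)))\<^sup>2 * (real (Suc (snd i)))\<^sup>2"

lemma qf_ge: "2 * (real (Suc (fst i)) * real (Suc (snd i))) \<le> qf i"
  using sum_squares_bound[of "real (Suc (fst i))" "real (Suc (snd i))"] unfolding qf_def by (simp only: mult.assoc)

lemma qf_pos: "0 < qf i" unfolding qf_def by (intro add_pos_pos) auto

lemma af_ge: "4 \<le> af i"
proof -
  have "1 * 1 \<le> (real (Suc (fst i)))\<^sup>2 * (real (Suc (snd i)))\<^sup>2"
    by (intro mult_mono one_le_power) auto
  thus ?thesis unfolding af_def by simp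
qed

lemma af_le: "af i \<le> (qf i)\<^sup>2"
  using power_mono[OF qf_ge, of i 2] unfolding af_def by (simp add: power_mult_distrib del: of_nat_Suc)

lemmas qf_af_conditions = qf_pos order.strict_trans2[OF zero_less_numeral af_ge] af_le

text \<open>The inequality of arithmetic and geometric means decouples the coordinates, so the
  double sum is dominated by a product of two zeta series.\<close>

lemma inverse_qf_power_le: "1 / qf i ^ k
    \<le> 1 / 2 ^ k * (case i of (m, n) \<Rightarrow> 1 / real (Suc m) ^ k * (1 / real (Suc n) ^ k))"
proof -
  have "1 / qf i ^ k \<le> 1 / (2 * (real (Suc (fst i)) * real (Suc (snd i)))) ^ k"
    using qf_pos[of i] qf_ge[of i] by (intro divide_left_mono power_mono mult_pos_pos zero_less_power) auto
  thus ?thesis by (simp add: case_prod_unfold power_mult_distrib mult.assoc del: of_nat_Suc)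
qed

lemma inverse_qf_power:
  assumes "k \<ge> 2"
  shows "(\<lambda>i. 1 / qf i ^ k) summable_on UNIV" "(\<Sum>\<^sub>\<infinity>i. 1 / qf i ^ k) \<le> (zeta_nat k)\<^sup>2 / 2 ^ k"
proof -
  have h: "((\<lambda>i. 1 / 2 ^ k * (case i of (m, n)
      \<Rightarrow> 1 / real (Suc m) ^ k * (1 / real (Suc n) ^ k)))
      has_sum 1 / 2 ^ k * (zeta_nat k * zeta_nat k)) UNIV"
    using has_sum_product_nonneg[OF zeta_nat_has_sum zeta_nat_has_sum, OF assms assms]
    by (intro has_sum_cmult_right) simp
  show s: "(\<lambda>i. 1 / qf i ^ k) summable_on UNIV"
    by (rule summable_on_comparison_test[OF has_sum_imp_summable[OF h] inverse_qf_power_le]) (simp add: qf_pos less_imp_le)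
  show "(\<Sum>\<^sub>\<infinity>i. 1 / qf i ^ k) \<le> (zeta_nat k)\<^sup>2 / 2 ^ k"
    using has_sum_mono[OF has_sum_infsum[OF s] h inverse_qf_power_le] by (simp add: power2_eq_square)
qed

lemma infsum_dominated:
  assumes "\<And>i. \<bar>f i\<bar> \<le> C * (1 / qf i ^ k)" "k \<ge> 2"
  shows "f summable_on UNIV" "\<bar>infsum f UNIV\<bar> \<le> C * (\<Sum>\<^sub>\<infinity>i. 1 / qf i ^ k)"
proof -
  have s: "(\<lambda>i. C * (1 / qf i ^ k)) summable_on UNIV"
    by (intro summable_on_cmult_right inverse_qf_power assms)
  show 1: "f summable_on UNIV"
    by (rule abs_summable_summable, rule summable_on_comparison_test[OF s]) (use assms in auto)
  show "\<bar>infsum f UNIV\<bar> \<le> C * (\<Sum>\<^sub>\<infinity>i. 1 / qf i ^ k)"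
    using norm_infsum_le[OF has_sum_infsum[OF 1] has_sum_infsum[OF s]] assms(1)
    unfolding infsum_cmult_right' by simp
qed

section \<open>The quadrant sums and their derivatives\<close>

definition H3 where "H3 u = (\<Sum>\<^sub>\<infinity>i. P3 (qf i) (af i) u)"
definition dH3 where "dH3 u = (\<Sum>\<^sub>\<infinity>i. dP3 (qf i) (af i) u)"
definition ddH3 where "ddH3 u = (\<Sum>\<^sub>\<infinity>i. ddP3 (qf i) (af i) u)"
definition H6 where "H6 u = (\<Sum>\<^sub>\<infinity>i. P6 (qf i) (af i) u)"
definition dH6 where "dH6 u = (\<Sum>\<^sub>\<infinity>i. dP6 (qf i) (af i) u)"
definition ddH6 where "ddH6 u = (\<Sum>\<^sub>\<infinity>i. ddP6 (qf i) (af i) u)"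

text \<open>The bounds on the derivatives grow with \<open>u\<close>, so the M-test is applied on a
  bounded interval. Its left end 1 stays included, since the value at \<open>u = 1\<close>
  determines \<open>b_a\<close>; derivatives there are one-sided.\<close>

lemma at_within_atLeast_1: "1 \<le> u \<Longrightarrow> at u within {1..} = at u within {1..u+1::real}"
  by (rule at_within_nhd[of _ "{..<u+1}"]) auto

lemma infsum_qf_af_deriv:
  fixes f f' :: "real \<Rightarrow> real \<Rightarrow> real \<Rightarrow> real"
  assumes D: "\<And>q a u. 0 < q \<Longrightarrow> 0 < a \<Longrightarrow> a
      \<le> q\<^sup>2 \<Longrightarrow> 1 \<le> u \<Longrightarrow> (f q a has_real_derivative f' q a u) (at u)"
    and f: "\<And>q a u. 0 < q \<Longrightarrow> 0 < a \<Longrightarrow> a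
        \<le> q\<^sup>2 \<Longrightarrow> 1 \<le> u \<Longrightarrow> \<bar>f q a u\<bar> \<le> C u * (1 / q ^ k)"
    and f': "\<And>q a u. 0 < q \<Longrightarrow> 0 < a \<Longrightarrow> a
        \<le> q\<^sup>2 \<Longrightarrow> 1 \<le> u \<Longrightarrow> \<bar>f' q a u\<bar> \<le> C' u * (1 / q ^ k)"
    and C': "\<And>x y. 1 \<le> x \<Longrightarrow> x \<le> y \<Longrightarrow> C' x \<le> C' y"
    and k: "k \<ge> 2" and u: "1 \<le> u"
  shows "((\<lambda>u. \<Sum>\<^sub>\<infinity>i. f (qf i) (af i) u) has_real_derivative (\<Sum>\<^sub>\<infinity>i. f' (qf i) (af i) u)) (at u within {1..})"
  unfolding at_within_atLeast_1[OF u]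
proof (rule has_field_derivative_infsum)
  show "\<bar>f' (qf i) (af i) x\<bar> \<le> C' (u + 1) * (1 / qf i ^ k)" if "x \<in> {1..u+1}"
    for i x
  proof -
    have "C' x * (1 / qf i ^ k) \<le> C' (u + 1) * (1 / qf i ^ k)"
      using that by (intro mult_right_mono C') (auto simp: qf_pos less_imp_le)
    thus ?thesis using f'[OF qf_af_conditions, of x i] that by force
  qed
  show "(\<lambda>i. C' (u + 1) * (1 / qf i ^ k)) summable_on UNIV"
    by (intro summable_on_cmult_right inverse_qf_power k)
  show "(\<lambda>i. f (qf i) (af i) x) summable_on UNIV" if "x \<in> {1..u+1}" for x
    by (rule infsum_dominated[of _ "C x" k]) (use f[OF qf_af_conditions] that k in auto)
  show "(f (qf i) (af i) has_real_derivative f' (qf i) (af i) x) (at x within {1..u + 1})"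
    if "x \<in> {1..u+1}" for i x
    by (rule has_field_derivative_at_within[OF D[OF qf_af_conditions]]) (use that in auto)
qed (use u in auto)

lemma H3_deriv: assumes "1 \<le> u" shows "(H3 has_real_derivative dH3 u) (at u within {1..})"
  unfolding H3_def[abs_def] dH3_def using assms
proof (rule infsum_qf_af_deriv[OF P3_deriv _ abs_dP3_le, rotated -1])
  show "\<bar>P3 q a u\<bar> \<le> (8 * u^3) * (1 / q ^ 3)" if "0 < q" "0 < a" "a \<le> q\<^sup>2" "1 \<le> u"
    for q a u
    using P3_bounds[OF that] by simp
qed (auto intro: power_mono)

lemma dH3_deriv: assumes "1 \<le> u" shows "(dH3 has_real_derivative ddH3 u) (at u within {1..})"
  unfolding dH3_def[abs_def] ddH3_def using assms
proof (rule infsum_qf_af_deriv[OF dP3_deriv abs_dP3_le, rotated -1])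
  \<comment> \<open>The term \<open>72 / u\<close> is weakened to 72, which makes monotonicity of
    the bound immediate.\<close>
  show "\<bar>ddP3 q a u\<bar> \<le> (96 * u + 72) * (1 / q ^ 3)" if "0 < q" "0 < a" "a \<le> q\<^sup>2" "1 \<le> u"
    for q a u
    by (rule order_trans[OF abs_ddP3_le[OF that]], rule mult_right_mono) (use that in \<open>auto simp: field_simps\<close>)
qed auto

lemma abs_P6_le:
  assumes "0 < q" "0 < a" "a \<le> q\<^sup>2" "1 \<le> u"
  shows "\<bar>P6 q a u\<bar> \<le> (64 * u^6 + 2) * (1 / q^6)"
proof -
  have "(P3 q a u)\<^sup>2 \<le> (8 * u^3 * (1 / q^3))\<^sup>2"
    using P3_bounds[OF assms] by (intro power_mono)
  also have "\<dots> = 64 * u^6 * (1 / q^6)"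
    by (simp add: power_mult_distrib power_divide power_mult[symmetric])
  finally have "(P3 q a u)\<^sup>2 \<le> 64 * u^6 * (1 / q^6)" .
  moreover have "0 \<le> 1 / pden q a u ^ 3" using pden_pos[OF assms] by simp
  moreover have "0 \<le> (P3 q a u)\<^sup>2" "2 / pden q a u ^ 3 = 2 * (1 / pden q a u ^ 3)" by auto
  moreover have "0 \<le> 64 * u^6 * (1 / q^6)" "0 \<le> 2 * (1 / q^6)" using assms by auto
  ultimately show ?thesis using inv_pden(3)[OF assms] unfolding P6_def distrib_right by linarith
qed

lemma H6_deriv: assumes "1 \<le> u" shows "(H6 has_real_derivative dH6 u) (at u within {1..})"
  unfolding H6_def[abs_def] dH6_def using assms
  by (rule infsum_qf_af_deriv[OF P6_deriv abs_P6_le abs_dP6_le, rotated -1]) (auto intro!: add_mono power_mono)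

lemma dH6_deriv: assumes "1 \<le> u" shows "(dH6 has_real_derivative ddH6 u) (at u within {1..})"
  unfolding dH6_def[abs_def] ddH6_def using assms
  by (rule infsum_qf_af_deriv[OF dP6_deriv abs_dP6_le abs_ddP6_le, rotated -1])
     (auto intro!: add_mono power_mono mult_left_mono)

abbreviation "S2 \<equiv> (\<Sum>\<^sub>\<infinity>i. 1 / qf i ^ 2)"
abbreviation "S3 \<equiv> (\<Sum>\<^sub>\<infinity>i. 1 / qf i ^ 3)"
abbreviation "S6 \<equiv> (\<Sum>\<^sub>\<infinity>i. 1 / qf i ^ 6)"

lemma abs_dH3_le: "1 \<le> u \<Longrightarrow> \<bar>dH3 u\<bar> \<le> (24 * u\<^sup>2 + 18) * S3"
  unfolding dH3_def by (rule infsum_dominated) (use abs_dP3_le[OF qf_af_conditions] in auto)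

lemma abs_ddH3_le: "1 \<le> u \<Longrightarrow> \<bar>ddH3 u\<bar> \<le> (96 * u + 72 / u) * S3"
  unfolding ddH3_def by (rule infsum_dominated) (use abs_ddP3_le[OF qf_af_conditions] in auto)

lemma abs_dH6_le: "1 \<le> u \<Longrightarrow> \<bar>dH6 u\<bar> \<le> (384 * u^5 + 288 * u^3 + 12) * S6"
  unfolding dH6_def by (rule infsum_dominated) (use abs_dP6_le[OF qf_af_conditions] in auto)

lemma ddH6_ge:
  assumes "1 \<le> u"
  shows "- (1536 * u^4 + 1152 * u\<^sup>2 + 84) * S6 \<le> ddH6 u"
proof -
  have "((\<lambda>i. - (1536 * u^4 + 1152 * u\<^sup>2 + 84) * (1 / qf i ^ 6)) has_sum
      - (1536 * u^4 + 1152 * u\<^sup>2 + 84) * S6) UNIV"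
    by (intro has_sum_cmult_right has_sum_infsum inverse_qf_power) auto
  moreover have "((\<lambda>i. ddP6 (qf i) (af i) u) has_sum ddH6 u) UNIV"
    unfolding ddH6_def by (rule has_sum_infsum, rule infsum_dominated(1)[OF abs_ddP6_le[OF qf_af_conditions assms]]) simp
  ultimately show ?thesis using ddP6_ge[OF qf_af_conditions assms] by (rule has_sum_mono)
qed

text \<open>Serves the limit at infinity, where only the order O(u) matters and not the size of
  \<open>S2\<close>. The constant is 30 = 12 + 18, merging the powers of \<open>1 / q\<close> by
  \<open>q >= 1\<close>.\<close>

lemma abs_dH3_le_linear:
  assumes "1 \<le> u"
  shows "\<bar>dH3 u\<bar> \<le> 30 * u * S2"
  unfolding dH3_def
proof (rule infsum_dominated)
  fix i
  have q: "1 \<le> qf i" unfolding qf_def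
    by (simp add: add_increasing2 one_le_power)
  have "1 / qf i ^ 3 \<le> 1 / qf i ^ 2"
    using q by (intro divide_left_mono power_increasing) auto
  also have "\<dots> \<le> u * (1 / qf i ^ 2)"
    using assms mult_right_mono[of 1 u "1 / qf i ^ 2"] by auto
  finally show "\<bar>dP3 (qf i) (af i) u\<bar> \<le> 30 * u * (1 / qf i ^ 2)"
    using abs_dP3_le_linear[OF qf_af_conditions assms af_ge, of i] by linarith
qed auto

text \<open>One power of \<open>u\<close> below the main term of \<open>dG6\<close>. The constant is
  492 = 16 * 30 + 12.\<close>

lemma abs_dH6_le_power4:
  assumes "1 \<le> u"
  shows "\<bar>dH6 u\<bar> \<le> 492 * u^4 * S2"
  unfolding dH6_def
proof (rule infsum_dominated)
  fix i
  have q: "1 \<le> qf i" unfolding qf_def by (simp add: add_increasing2 one_le_power)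
  have le: "1 / qf i ^ k \<le> 1" "1 / qf i ^ 6 \<le> 1 / qf i ^ 2" "1 / qf i ^ 3 \<le> 1 / qf i ^ 2"
    for k
    using q by (auto intro!: divide_left_mono power_increasing simp: divide_simps)
  have "1 / qf i ^ 3 \<le> u * (1 / qf i ^ 2)"
    using le(3) assms mult_right_mono[of 1 u "1 / qf i ^ 2"] by auto
  hence "\<bar>dP3 (qf i) (af i) u\<bar> \<le> 30 * u * (1 / qf i ^ 2)"
    using abs_dP3_le_linear[OF qf_af_conditions assms af_ge, of i] by linarith
  hence "16 * u^3 * (1 / qf i^3) * \<bar>dP3 (qf i) (af i) u\<bar>
      \<le> 16 * u^3 * 1 * (30 * u * (1 / qf i ^ 2))"
    using le(1)[of 3] assms q by (intro mult_mono) auto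
  moreover have "1 / qf i ^ 6 \<le> u^4 * (1 / qf i ^ 2)"
    using le(2) assms mult_right_mono[of 1 "u^4" "1 / qf i ^ 2"] by auto
  moreover have "16 * u^3 * 1 * (30 * u * (1 / qf i ^ 2)) = 480 * (u^4 * (1 / qf i ^ 2))"
    by (simp add: eval_nat_numeral)
  ultimately show "\<bar>dP6 (qf i) (af i) u\<bar> \<le> 492 * u^4 * (1 / qf i ^ 2)"
    using abs_dP6_le_dP3[OF qf_af_conditions assms, of i] by linarith
qed auto

section \<open>The Epstein zeta function on the imaginary axis\<close>

text \<open>The Epstein summand at \<open>z = iy\<close> after cancelling \<open>y^k\<close>. In
  this form replacing \<open>y\<close> by \<open>1 / y\<close> amounts to exchanging
  \<open>m\<close> and \<open>n\<close>.\<close>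

definition lattice_term :: "nat \<Rightarrow> real \<Rightarrow> int \<times> int \<Rightarrow> real" where
  "lattice_term k y = (\<lambda>(m, n). 1 / ((real_of_int m)\<^sup>2 * y + (real_of_int n)\<^sup>2 / y) ^ k)"

lemma epstein_term_eq:
  assumes "y > 0" "(m, n) \<noteq> (0, 0)"
  shows "y powr real k / cmod (of_int m * (\<i> * of_real y) + of_int n) powr (2 * real k)
      = lattice_term k y (m, n)"
proof -
  have c: "cmod (of_int m * (\<i> * of_real y) + of_int n) ^ 2
      = (real_of_int m * y)\<^sup>2 + (real_of_int n)\<^sup>2"
    by (simp add: cmod_power2)
  have e: "of_int m * (\<i> * of_real y) + of_int n \<noteq> (0::complex)"
    using assms by (auto simp: complex_eq_iff)
  have "cmod (of_int m * (\<i> * of_real y) + of_int n) powr (2 * real k)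
      = cmod (of_int m * (\<i> * of_real y) + of_int n) powr real (2 * k)" by simp
  also have "\<dots> = cmod (of_int m * (\<i> * of_real y) + of_int n) ^ (2 * k)"
    by (rule powr_realpow) (use e in simp)
  also have "\<dots> = ((real_of_int m * y)\<^sup>2 + (real_of_int n)\<^sup>2) ^ k"
    unfolding power_mult c ..
  also have "(real_of_int m * y)\<^sup>2 + (real_of_int n)\<^sup>2
      = y * ((real_of_int m)\<^sup>2 * y + (real_of_int n)\<^sup>2 / y)"
    using assms by (simp add: field_simps power2_eq_square)
  finally show ?thesis using assms by (simp add: lattice_term_def powr_realpow power_mult_distrib)
qed

lemma epstein_zeta_imaginary_axis:
  assumes "y > 0"
  shows "epstein_zeta (real k) (\<i> * of_real y) = infsum (lattice_term k y) (UNIV - {(0, 0)})"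
  unfolding epstein_zeta_def
  by (rule infsum_cong) (use epstein_term_eq[OF assms, of _ _ k] in auto)

definition quadrant_term :: "nat \<Rightarrow> real \<Rightarrow> nat \<times> nat \<Rightarrow> real" where
  "quadrant_term k y i = 1 / ((real (Suc (fst i)))\<^sup>2 * y + (real (Suc (snd i)))\<^sup>2 / y) ^ k"

text \<open>The signs \<open>s\<close> and \<open>t\<close> select one of the four open quadrants;
  reflections preserve the squares, so all four have the same sum.\<close>

lemma quadrant_has_sum:
  assumes "(quadrant_term k y has_sum X) UNIV" "s = 1 \<or> s = -1" "t = 1 \<or> t = -1"
  shows "(lattice_term k y has_sum X) {(m, n). 0 < s * m \<and> 0 < t * n}"
proof -
  define h where "h = (\<lambda>i::nat \<times> nat. (s * (int (fst i) + 1), t * (int (snd i) + 1)))"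
  have "bij_betw h UNIV {(m, n). 0 < s * m \<and> 0 < t * n}"
    by (rule bij_betwI[where g = "\<lambda>(m, n). (nat (s * m - 1), nat (t * n - 1))"])
       (use assms(2,3) in \<open>auto simp: h_def\<close>)
  moreover have "lattice_term k y (h i) = quadrant_term k y i" for i
    using assms(2,3) by (auto simp: lattice_term_def quadrant_term_def h_def power2_eq_square algebra_simps)
  ultimately show ?thesis using has_sum_reindex_bij_betw[of h UNIV _ "lattice_term k y" X] assms(1) by simp
qed

lemma axis_has_sum:
  assumes "y > 0" "k \<ge> 1" "s = 1 \<or> s = -1"
  shows "(lattice_term k y has_sum (y ^ k * zeta_nat (2 * k))) {(m, n). m = 0 \<and> 0 < s * n}"
    "(lattice_term k y has_sum (1 / y ^ k * zeta_nat (2 * k))) {(m, n). n = 0 \<and> 0 < s * m}"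
proof -
  have z: "((\<lambda>n. c * (1 / real (Suc n) ^ (2 * k))) has_sum c * zeta_nat (2 * k)) UNIV"
    for c :: real
    using assms by (intro has_sum_cmult_right zeta_nat_has_sum) auto
  have sq: "(of_int (s * (int n + 1)))\<^sup>2 = (real (Suc n))\<^sup>2" for n
    using assms(3) by (auto simp: power2_eq_square algebra_simps)
  define h where "h = (\<lambda>n::nat. (0::int, s * (int n + 1)))"
  have bh: "bij_betw h UNIV {(m, n). m = 0 \<and> 0 < s * n}"
    by (rule bij_betwI[where g = "\<lambda>(m, n). nat (s * n - 1)"]) (use assms(3) in \<open>auto simp: h_def\<close>)
  have eh: "lattice_term k y (h n) = y ^ k * (1 / real (Suc n) ^ (2 * k))" for n
    unfolding lattice_term_def h_def prod.case sq using assms(1)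
    by (simp add: power_divide power_mult del: of_nat_Suc)
  show "(lattice_term k y has_sum (y ^ k * zeta_nat (2 * k))) {(m, n). m = 0 \<and> 0 < s * n}"
    unfolding has_sum_reindex_bij_betw[OF bh, symmetric] eh by (rule z)
  define g where "g = (\<lambda>n::nat. (s * (int n + 1), 0::int))"
  have bg: "bij_betw g UNIV {(m, n). n = 0 \<and> 0 < s * m}"
    by (rule bij_betwI[where g = "\<lambda>(m, n). nat (s * m - 1)"]) (use assms(3) in \<open>auto simp: g_def\<close>)
  have eg: "lattice_term k y (g n) = 1 / y ^ k * (1 / real (Suc n) ^ (2 * k))" for n
    unfolding lattice_term_def g_def prod.case sq using assms(1)
    by (simp add: power_mult_distrib power_mult del: of_nat_Suc)
  show "(lattice_term k y has_sum (1 / y ^ k * zeta_nat (2 * k))) {(m, n). n = 0 \<and> 0 < s * m}"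
    unfolding has_sum_reindex_bij_betw[OF bg, symmetric] eg by (rule z)
qed

lemma quadrant_term_summable:
  assumes "y > 0" "k \<ge> 2"
  shows "quadrant_term k y summable_on UNIV"
proof -
  have h: "(\<lambda>i. 1 / 2 ^ k * (case i of (m, n)
      \<Rightarrow> 1 / real (Suc m) ^ k * (1 / real (Suc n) ^ k))) summable_on UNIV"
    using has_sum_product_nonneg[OF zeta_nat_has_sum zeta_nat_has_sum, OF assms(2) assms(2)]
    by (intro summable_on_cmult_right has_sum_imp_summable) simp
  show ?thesis
  proof (rule summable_on_comparison_test[OF h])
    fix i :: "nat \<times> nat"
    define a b where "a = real (Suc (fst i))" and "b = real (Suc (snd i))"
    have ab: "a > 0" "b > 0" by (auto simp: a_def b_def)
    have "2 * a * b * y \<le> a\<^sup>2 * y\<^sup>2 + b\<^sup>2"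
      using sum_squares_bound[of "a * y" b] by (simp add: power_mult_distrib mult_ac)
    hence "2 * (a * b) \<le> a\<^sup>2 * y + b\<^sup>2 / y"
      using assms(1) by (simp add: field_simps power2_eq_square)
    hence "1 / (a\<^sup>2 * y + b\<^sup>2 / y) ^ k \<le> 1 / (2 * (a * b)) ^ k"
      using ab assms(1) by (intro divide_left_mono power_mono mult_pos_pos zero_less_power add_pos_pos) auto
    thus "quadrant_term k y i
        \<le> 1 / 2 ^ k * (case i of (m, n) \<Rightarrow> 1 / real (Suc m) ^ k * (1 / real (Suc n) ^ k))"
      unfolding quadrant_term_def a_def b_def
      by (simp add: case_prod_unfold power_mult_distrib mult.assoc del: of_nat_Suc)
    show "0 \<le> quadrant_term k y i" using assms(1) by (simp add: quadrant_term_def)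
  qed
qed

lemma lattice_sum_eq:
  assumes "y > 0" "k \<ge> 2"
  shows "infsum (lattice_term k y) (UNIV - {(0, 0)})
    = 2 * zeta_nat (2 * k) * (y ^ k + 1 / y ^ k) + 2 * (\<Sum>\<^sub>\<infinity>i. quadrant_term k y i + quadrant_term k y (prod.swap i))"
proof -
  define X where "X = infsum (quadrant_term k y) UNIV"
  have X: "(quadrant_term k y has_sum X) UNIV"
    unfolding X_def using quadrant_term_summable[OF assms] by simp
  let ?Q = "\<lambda>s t. {(m::int, n::int). 0 < s * m \<and> 0 < t * n}"
  let ?V = "\<lambda>s. {(m::int, n::int). m = 0 \<and> 0 < s * n}" and ?H = "\<lambda>s. {(m::int, n::int). n = 0 \<and> 0 < s * m}"
  note ax = axis_has_sum[of y k] and qu = quadrant_has_sum[OF X]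
  \<comment> \<open>The punctured lattice splits into four open quadrants and four
    half-axes.\<close>
  have u: "UNIV - {(0, 0)}
      = (((?Q 1 1 \<union> ?Q 1 (-1)) \<union> (?Q (-1) 1 \<union> ?Q (-1) (-1))) \<union> (?V 1 \<union> ?V (-1))) \<union> (?H 1 \<union> ?H (-1))"
    by (rule set_eqI, clarsimp, presburger)
  have "(lattice_term k y has_sum (((X + X) + (X + X)) + (y^k * zeta_nat (2*k) + y^k * zeta_nat (2*k)))
      + (1/y^k * zeta_nat (2*k) + 1/y^k * zeta_nat (2*k))) (UNIV - {(0, 0)})"
    unfolding u using assms by (intro has_sum_Un_disjoint ax qu) auto
  hence 1: "infsum (lattice_term k y) (UNIV - {(0, 0)}) = 2 * zeta_nat (2 * k) * (y ^ k + 1 / y ^ k) + 4 * X"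
    by (auto dest!: infsumI simp: algebra_simps)
  \<comment> \<open>Each term is paired with its mirror image: only the pair is symmetric under
    \<open>y -> 1 / y\<close> and hence a function of \<open>u_of_y y\<close>.\<close>
  have "((\<lambda>i. quadrant_term k y (prod.swap i)) has_sum X) UNIV"
    using X has_sum_reindex_bij_betw[OF bij_swap, of "quadrant_term k y" X] by simp
  from infsumI[OF has_sum_add[OF X this]] 1 show ?thesis by simp
qed

definition u_of_y :: "real \<Rightarrow> real" where "u_of_y y = (y + 1 / y) / 2"

text \<open>Swapping the coordinates exchanges \<open>A\<close> and \<open>B\<close>, so each pair
  is a power sum of \<open>1 / A\<close> and \<open>1 / B\<close> and can be expressed through
  \<open>A + B\<close> and \<open>A * B\<close>.\<close>

lemma quadrant_term_pair:
  assumes "y > 0"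
  shows "quadrant_term 3 y i + quadrant_term 3 y (prod.swap i) = P3 (qf i) (af i) (u_of_y y)"
    "quadrant_term 6 y i + quadrant_term 6 y (prod.swap i) = P6 (qf i) (af i) (u_of_y y)"
proof -
  define a b where "a = real (Suc (fst i))" and "b = real (Suc (snd i))"
  have ab: "a > 0" "b > 0" by (auto simp: a_def b_def)
  define A B where "A = a\<^sup>2 * y + b\<^sup>2 / y" and "B = b\<^sup>2 * y + a\<^sup>2 / y"
  have AB: "A > 0" "B > 0" using ab assms by (auto simp: A_def B_def intro!: add_pos_pos)
  have p: "pden (qf i) (af i) (u_of_y y) = A * B"
  proof -
    \<comment> \<open>With \<open>1 / y\<close> treated as a second variable, this relation alone
      makes the claim a polynomial identity.\<close>
    have "y * (1 / y) = 1" using assms by simp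
    hence "(a\<^sup>2 + b\<^sup>2)\<^sup>2 + 4 * a\<^sup>2 * b\<^sup>2 * ((y + 1 / y)\<^sup>2 / 4 - 1)
        = (a\<^sup>2 * y + b\<^sup>2 * (1 / y)) * (b\<^sup>2 * y + a\<^sup>2 * (1 / y))"
      by algebra
    thus ?thesis
      unfolding pden_def qf_def af_def u_of_y_def A_def B_def a_def[symmetric] b_def[symmetric]
      by (simp add: power_divide)
  qed
  have s: "2 * qf i * u_of_y y = A + B"
    unfolding qf_def u_of_y_def A_def B_def a_def[symmetric] b_def[symmetric]
    using assms by (simp add: field_simps power2_eq_square)
  have q: "quadrant_term k y i = 1 / A ^ k" "quadrant_term k y (prod.swap i) = 1 / B ^ k" for k
    by (auto simp: quadrant_term_def A_def B_def a_def b_def)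
  have "P3 (qf i) (af i) (u_of_y y)
      = (2 * qf i * u_of_y y) ^ 3 / (A * B) ^ 3 - 3 * (2 * qf i * u_of_y y) / (A * B)\<^sup>2"
    unfolding P3_def p by (simp add: power_mult_distrib)
  also have "\<dots> = 1 / A ^ 3 + 1 / B ^ 3"
  proof -
    have "(A + B) / (A * B) = 1 / A + 1 / B" using AB by (simp add: field_simps)
    hence "(A + B) ^ 3 / (A * B) ^ 3 = (1 / A + 1 / B) ^ 3"
      "3 * (A + B) / (A * B)\<^sup>2 = 3 * (1 / A + 1 / B) * (1 / A * (1 / B))"
      using AB by (simp_all add: power_divide[symmetric] power2_eq_square field_simps)
    moreover have "(x + z) ^ 3 - 3 * (x + z) * (x * z) = x ^ 3 + z ^ 3" for x z :: real
      by (simp add: power3_eq_cube algebra_simps)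
    ultimately have "(A + B) ^ 3 / (A * B) ^ 3 - 3 * (A + B) / (A * B)\<^sup>2 = (1 / A) ^ 3 + (1 / B) ^ 3"
      by (simp only:)
    thus ?thesis unfolding s by (simp add: power_divide)
  qed
  finally have P3: "P3 (qf i) (af i) (u_of_y y) = 1 / A ^ 3 + 1 / B ^ 3" .
  thus "quadrant_term 3 y i + quadrant_term 3 y (prod.swap i) = P3 (qf i) (af i) (u_of_y y)"
    by (simp add: q)
  show "quadrant_term 6 y i + quadrant_term 6 y (prod.swap i) = P6 (qf i) (af i) (u_of_y y)"
    unfolding P6_def P3 p q
    by (simp add: power2_eq_square power_mult_distrib algebra_simps power_add[symmetric])
qed

text \<open>The polynomials here and in \<open>G6\<close> are the Chebyshev polynomials of degree 3
  and 6, through \<open>y^k + 1 / y^k = 2 * T_k(u)\<close>.\<close>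

definition G3 where "G3 u = 4 * zeta_nat 6 * (4 * u^3 - 3 * u) + 2 * H3 u"
definition G6 where "G6 u = 4 * zeta_nat 12 * (32 * u^6 - 48 * u^4 + 18 * u\<^sup>2 - 1) + 2 * H6 u"

lemma epstein_zeta_3:
  assumes "y > 0" shows "epstein_zeta 3 (\<i> * of_real y) = G3 (u_of_y y)"
proof -
  have "y ^ 3 + 1 / y ^ 3 = 2 * (4 * u_of_y y ^ 3 - 3 * u_of_y y)"
    unfolding u_of_y_def using assms by (simp add: field_simps eval_nat_numeral)
  moreover have "(\<Sum>\<^sub>\<infinity>i. quadrant_term 3 y i + quadrant_term 3 y (prod.swap i))
      = H3 (u_of_y y)"
    unfolding quadrant_term_pair[OF assms] H3_def ..
  ultimately show ?thesis
    using epstein_zeta_imaginary_axis[OF assms, of 3] lattice_sum_eq[OF assms, of 3] unfolding G3_def by simp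
qed

lemma epstein_zeta_6:
  assumes "y > 0" shows "epstein_zeta 6 (\<i> * of_real y) = G6 (u_of_y y)"
proof -
  have "y ^ 6 + 1 / y ^ 6 = 2 * (32 * u_of_y y ^ 6 - 48 * u_of_y y ^ 4 + 18 * (u_of_y y)\<^sup>2 - 1)"
  proof -
    have "y ^ 3 + 1 / y ^ 3 = 2 * (4 * u_of_y y ^ 3 - 3 * u_of_y y)"
      unfolding u_of_y_def using assms by (simp add: field_simps eval_nat_numeral)
    moreover have "y ^ 6 + 1 / y ^ 6 = (y ^ 3 + 1 / y ^ 3)\<^sup>2 - 2"
      using assms by (simp add: power2_sum power_divide power_mult[symmetric])
    ultimately have "y ^ 6 + 1 / y ^ 6 = (2 * (4 * u_of_y y ^ 3 - 3 * u_of_y y))\<^sup>2 - 2"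
      by simp
    thus ?thesis by (simp add: power2_eq_square algebra_simps eval_nat_numeral)
  qed
  moreover have "(\<Sum>\<^sub>\<infinity>i. quadrant_term 6 y i + quadrant_term 6 y (prod.swap i))
      = H6 (u_of_y y)"
    unfolding quadrant_term_pair[OF assms] H6_def ..
  ultimately show ?thesis
    using epstein_zeta_imaginary_axis[OF assms, of 6] lattice_sum_eq[OF assms, of 6] unfolding G6_def by simp
qed

section \<open>Numerical values at \<open>u = 1\<close>\<close>

definition grid :: "nat \<Rightarrow> (nat \<times> nat) set" where "grid N = {..<N} \<times> {..<N}"

text \<open>The tail is summed as a product: \<open>q\<^sup>3 \<ge> (m\<^sup>2 + N\<^sup>2) n\<^sup>4\<close> for \<open>n > N\<close>.\<close>

lemma strip_tail:
  assumes N: "N \<ge> 1"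
  obtains X where "((\<lambda>i. 1 / qf i ^ 3) has_sum X) (UNIV \<times> {N..})" "X \<le> 2 / (3 * real N ^ 4)"
proof -
  define f where "f = (\<lambda>i::nat. 2 * (1 / real (Suc (i + N)) ^ 2))"
  define g where "g = (\<lambda>j::nat. 1 / real (Suc (j + N)) ^ 4)"
  have s: "summable (\<lambda>n. 1 / real (Suc (n + N)) ^ Suc k)" if "k \<ge> 1" for k
    using summable_iff_shift[of "\<lambda>n. 1 / real (Suc n) ^ Suc k" N] inverse_power_sums[OF that] by simp
  define F where "F = (\<Sum>i. 1 / real (Suc (i + N)) ^ 2)"
  have F: "(f has_sum 2 * F) UNIV"
    unfolding f_def F_def using s[of 1]
    by (intro has_sum_cmult_right sums_nonneg_imp_has_sum summable_sums) (auto simp: numeral_2_eq_2)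
  have F_le: "F \<le> 1 / N"
    unfolding F_def using inverse_power_tail[OF N, of 1] by (simp add: numeral_2_eq_2)
  define G where "G = (\<Sum>j. 1 / real (Suc (j + N)) ^ 4)"
  have G: "(g has_sum G) UNIV" "G \<le> 1 / (3 * real N ^ 3)"
    unfolding g_def G_def using s[of 3] inverse_power_tail[OF N, of 3]
    by (auto intro!: sums_nonneg_imp_has_sum summable_sums simp del: of_nat_Suc)
  have fg: "((\<lambda>(i, j). f i * g j) has_sum 2 * F * G) (UNIV \<times> UNIV)"
    by (rule has_sum_product_nonneg[OF F G(1)]) (auto simp: f_def g_def)
  define h where "h = (\<lambda>i::nat \<times> nat. (fst i, snd i + N))"
  have h: "bij_betw h UNIV (UNIV \<times> {N..})"
    by (rule bij_betwI[where g = "\<lambda>i. (fst i, snd i - N)"]) (auto simp: h_def)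
  define X where "X = infsum (\<lambda>i. 1 / qf i ^ 3) (UNIV \<times> {N..})"
  have X: "((\<lambda>i. 1 / qf i ^ 3) has_sum X) (UNIV \<times> {N..})"
    unfolding X_def by (intro has_sum_infsum summable_on_subset_banach[OF inverse_qf_power(1)]) auto
  have "((\<lambda>i. 1 / qf (h i) ^ 3) has_sum X) UNIV"
    using X has_sum_reindex_bij_betw[OF h, of "\<lambda>i. 1 / qf i ^ 3" X] by simp
  moreover have "((\<lambda>i. f (fst i) * g (snd i)) has_sum 2 * F * G) UNIV"
    using fg by (simp add: case_prod_unfold)
  moreover have "1 / qf (h i) ^ 3 \<le> f (fst i) * g (snd i)" for i
  proof -
    define a b where "a = real (Suc (fst i))" and "b = real (Suc (snd i + N))"
    have ab: "a > 0" "b > 0" "real N \<le> b" by (auto simp: a_def b_def)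
    \<comment> \<open>Replacing \<open>a^2 + N^2\<close> by half the square of \<open>a + N\<close>
      turns the sum over the first coordinate into a shifted tail of the series of
      \<open>1 / n^2\<close>.\<close>
    have "(a + N)\<^sup>2 \<le> 2 * (a\<^sup>2 + (real N)\<^sup>2)"
      using sum_squares_bound[of a "real N"] by (simp add: power2_sum)
    also have "\<dots> \<le> 2 * (a\<^sup>2 + b\<^sup>2)" using ab by (simp add: power_mono)
    finally have 1: "(a + N)\<^sup>2 / 2 \<le> a\<^sup>2 + b\<^sup>2" by simp
    have 2: "b ^ 4 \<le> (a\<^sup>2 + b\<^sup>2)\<^sup>2"
      using power_mono[of "b\<^sup>2" "a\<^sup>2 + b\<^sup>2" 2] by (simp add: power_mult[symmetric])
    have "(a + N)\<^sup>2 / 2 * b ^ 4 \<le> (a\<^sup>2 + b\<^sup>2) * (a\<^sup>2 + b\<^sup>2)\<^sup>2"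
      using 1 2 by (intro mult_mono) auto
    hence "1 / (a\<^sup>2 + b\<^sup>2) ^ 3 \<le> 1 / ((a + N)\<^sup>2 / 2 * b ^ 4)"
      using ab N by (intro divide_left_mono mult_pos_pos zero_less_power add_pos_pos)
        (auto simp: power3_eq_cube power2_eq_square mult.assoc)
    thus ?thesis by (simp add: f_def g_def qf_def h_def a_def b_def add_ac)
  qed
  ultimately have "X \<le> 2 * F * G" by (rule has_sum_mono)
  also have "\<dots> \<le> 2 * (1 / N) * (1 / (3 * real N ^ 3))"
  proof -
    have "0 \<le> G" using has_sum_nonneg[OF G(1)] by (auto simp: g_def)
    moreover have "0 \<le> F" using has_sum_nonneg[OF F] by (auto simp: f_def)
    ultimately show ?thesis using F_le G(2) by (intro mult_mono) auto
  qed
  also have "\<dots> = 2 / (3 * real N ^ 4)" by (simp add: eval_nat_numeral)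
  finally show ?thesis using X that by blast
qed

text \<open>The complement of the grid consists of one full strip and part of its mirror image,
  hence at most twice the strip bound.\<close>

lemma grid_tail:
  assumes N: "N \<ge> 1"
  shows "infsum (\<lambda>i. 1 / qf i ^ 3) (- grid N) \<le> 4 / (3 * real N ^ 4)"
proof -
  obtain X where X: "((\<lambda>i. 1 / qf i ^ 3) has_sum X) (UNIV \<times> {N..})" "X \<le> 2 / (3 * real N ^ 4)"
    using strip_tail[OF N] .
  have Xs: "((\<lambda>i. 1 / qf i ^ 3) has_sum X) ({N..} \<times> UNIV)"
    using X(1) has_sum_swap[where f = "\<lambda>i. 1 / qf i ^ 3" and S = X and A = UNIV and B = "{N..}"]
    by (simp add: case_prod_unfold qf_def add.commute)
  define Y where "Y = infsum (\<lambda>i. 1 / qf i ^ 3) ({N..} \<times> {..<N})"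
  have Y: "((\<lambda>i. 1 / qf i ^ 3) has_sum Y) ({N..} \<times> {..<N})"
    unfolding Y_def by (intro has_sum_infsum summable_on_subset_banach[OF inverse_qf_power(1)]) auto
  have YX: "Y \<le> X" by (rule has_sum_mono2[OF Y Xs]) (auto simp: qf_pos less_imp_le)
  have "- grid N = (UNIV \<times> {N..}) \<union> ({N..} \<times> {..<N})" by (auto simp: grid_def)
  moreover have "((\<lambda>i. 1 / qf i ^ 3)
      has_sum X + Y) ((UNIV \<times> {N..}) \<union> ({N..} \<times> {..<N}))"
    by (intro has_sum_Un_disjoint X Y) auto
  ultimately show ?thesis using YX X(2) by (simp add: infsumI)
qed

text \<open>Separate constants \<open>L\<close> and \<open>U\<close> exploit that the terms at
  \<open>u = 1\<close> are much smaller on the negative side than on the positive one.\<close>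

lemma infsum_grid_bounds:
  fixes f :: "nat \<times> nat \<Rightarrow> real"
  assumes f: "f summable_on UNIV" and N: "N \<ge> 1" and LU: "L \<le> 0" "0 \<le> U"
    and b: "\<And>i. i \<notin> grid N \<Longrightarrow> L * (1 / qf i ^ 3) \<le> f i" "\<And>i. i \<notin> grid N \<Longrightarrow> f i \<le> U * (1 / qf i ^ 3)"
  shows "sum f (grid N) + L * (4 / (3 * real N ^ 4)) \<le> infsum f UNIV"
    "infsum f UNIV \<le> sum f (grid N) + U * (4 / (3 * real N ^ 4))"
proof -
  let ?T = "infsum (\<lambda>i. 1 / qf i ^ 3) (- grid N)"
  have fin: "finite (grid N)" by (simp add: grid_def)
  have fc: "(f has_sum infsum f (- grid N)) (- grid N)"
    by (intro has_sum_infsum summable_on_subset_banach[OF f]) auto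
  have T: "((\<lambda>i. 1 / qf i ^ 3) has_sum ?T) (- grid N)"
    by (intro has_sum_infsum summable_on_subset_banach[OF inverse_qf_power(1)]) auto
  have "(f has_sum sum f (grid N) + infsum f (- grid N)) (grid N \<union> - grid N)"
    by (intro has_sum_Un_disjoint fc) (use fin in auto)
  hence e: "infsum f UNIV = sum f (grid N) + infsum f (- grid N)" by (simp add: infsumI)
  have "L * ?T \<le> infsum f (- grid N)"
    by (rule has_sum_mono[OF has_sum_cmult_right[OF T] fc]) (use b in auto)
  moreover have "infsum f (- grid N) \<le> U * ?T"
    by (rule has_sum_mono[OF fc has_sum_cmult_right[OF T]]) (use b in auto)
  moreover have "U * ?T \<le> U * (4 / (3 * real N ^ 4))" "L * (4 / (3 * real N ^ 4)) \<le> L * ?T"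
    using grid_tail[OF N] LU by (auto intro: mult_left_mono mult_left_mono_neg simp del: times_divide_eq_right)
  ultimately show "sum f (grid N) + L * (4 / (3 * real N ^ 4)) \<le> infsum f UNIV"
    "infsum f UNIV \<le> sum f (grid N) + U * (4 / (3 * real N ^ 4))" unfolding e by linarith+
qed

lemma dP3_1: "q > 0 \<Longrightarrow> dP3 q a 1 = (18 - 24 * (a / q\<^sup>2)) * (1 / q^3)"
  by (simp add: dP3_def pden_def field_simps eval_nat_numeral)

lemma dP6_1: "q > 0 \<Longrightarrow> dP6 q a 1 = (72 - 84 * (a / q\<^sup>2)) * (1 / q^6)"
  unfolding dP6_def dP3_1 by (simp add: P3_def pden_def field_simps eval_nat_numeral)

text \<open>The terms at \<open>u = 1\<close> scaled by \<open>10\<^sup>9\<close> and rounded down, so that the finite sums become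
  integer computations.\<close>

definition fl3 :: "int \<Rightarrow> int \<Rightarrow> int" where
  "fl3 m n = (let q = m * m + n * n in (10^9 * (18 * q * q - 96 * m * m * n * n)) div q ^ 5)"
definition fl6 :: "int \<Rightarrow> int \<Rightarrow> int" where
  "fl6 m n = (let q = m * m + n * n in (10^9 * (72 * q * q - 336 * m * m * n * n)) div q ^ 8)"

text \<open>For N = 25 the tail bound leaves an uncertainty below 10^-4, enough for the digits of
  \<open>b_a\<close>; the faster decay of the terms in \<open>fl6\<close> permits N = 6.\<close>

lemma fl3_sum: "(\<Sum>i<25::nat. \<Sum>j<25::nat. fl3 (int (Suc i)) (int (Suc j))) = -695050748"
  by code_simp

lemma fl6_sum: "(\<Sum>i<6::nat. \<Sum>j<6::nat. fl6 (int (Suc i)) (int (Suc j))) = -185122216"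
  by code_simp

lemma div_bounds:
  fixes x :: real and n d :: int
  assumes "d > 0" "x = of_int n / of_int d"
  shows "of_int (n div d) \<le> x" "x \<le> of_int (n div d) + 1"
proof -
  have "n div d = \<lfloor>x\<rfloor>" unfolding assms by (rule floor_divide_of_int_eq[symmetric])
  thus "of_int (n div d) \<le> x" "x \<le> of_int (n div d) + 1" by linarith+
qed

text \<open>Each rounding loses at most one unit of 10^-9, hence the accumulated error of N * N
  units.\<close>

lemma grid_sum_bounds:
  fixes f :: "nat \<times> nat \<Rightarrow> real" and g :: "int \<Rightarrow> int \<Rightarrow> int"
  assumes "\<And>i j. of_int (g (int (Suc i)) (int (Suc j))) \<le> 10^9 * f (i, j)"
    "\<And>i j. 10^9 * f (i, j) \<le> of_int (g (int (Suc i)) (int (Suc j))) + 1"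
    and S: "(\<Sum>i<N. \<Sum>j<N. g (int (Suc i)) (int (Suc j))) = S"
  shows "of_int S \<le> 10^9 * sum f (grid N)" "10^9 * sum f (grid N) \<le> of_int S + real N * real N"
proof -
  have e: "10^9 * sum f (grid N) = (\<Sum>i<N. \<Sum>j<N. 10^9 * f (i, j))"
    unfolding grid_def by (simp add: sum.cartesian_product sum_distrib_left case_prod_unfold)
  have s: "real_of_int S = (\<Sum>i<N. \<Sum>j<N. of_int (g (int (Suc i)) (int (Suc j))))"
    unfolding S[symmetric] by simp
  show "of_int S \<le> 10^9 * sum f (grid N)"
    unfolding e s by (intro sum_mono assms)
  have "10^9 * sum f (grid N) \<le> (\<Sum>i<N. \<Sum>j<N. of_int (g (int (Suc i)) (int (Suc j))) + 1)"
    unfolding e by (intro sum_mono assms)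
  also have "\<dots> = of_int S + real N * real N" unfolding s by (simp add: sum.distrib)
  finally show "10^9 * sum f (grid N) \<le> of_int S + real N * real N" .
qed

lemma af_qf_frac: "0 \<le> af i / (qf i)\<^sup>2" "af i / (qf i)\<^sup>2 \<le> 1"
  using af_le[of i] af_ge[of i] qf_pos[of i] by (auto simp: divide_simps)

lemma dP3_fl3:
  fixes i j :: nat
  defines "f \<equiv> 10^9 * dP3 (qf (i, j)) (af (i, j)) 1"
  shows "of_int (fl3 (int (Suc i)) (int (Suc j))) \<le> f" "f \<le> of_int (fl3 (int (Suc i)) (int (Suc j))) + 1"
proof -
  define m n where "m = int (Suc i)" and "n = int (Suc j)"
  have mn: "m > 0" "n > 0" by (auto simp: m_def n_def)
  define q where "q = m * m + n * n"
  have q: "q > 0" using mn by (auto simp: q_def intro: add_pos_pos)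
  have qq: "qf (i, j) = of_int q" by (simp add: qf_def q_def m_def n_def power2_eq_square)
  have aa: "af (i, j) = of_int (4 * m * m * n * n)"
    by (simp add: af_def m_def n_def power2_eq_square)
  have "f = of_int (10^9 * (18 * q * q - 96 * m * m * n * n)) / of_int (q ^ 5)"
    unfolding f_def qq aa using q by (simp add: dP3_1 field_simps eval_nat_numeral)
  from div_bounds[OF _ this] q
  show "of_int (fl3 (int (Suc i)) (int (Suc j))) \<le> f" "f \<le> of_int (fl3 (int (Suc i)) (int (Suc j))) + 1"
    unfolding fl3_def Let_def m_def[symmetric] n_def[symmetric] q_def[symmetric] by auto
qed

lemma dP6_fl6:
  fixes i j :: nat
  defines "f \<equiv> 10^9 * dP6 (qf (i, j)) (af (i, j)) 1"
  shows "of_int (fl6 (int (Suc i)) (int (Suc j))) \<le> f" "f \<le> of_int (fl6 (int (Suc i)) (int (Suc j))) + 1"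
proof -
  define m n where "m = int (Suc i)" and "n = int (Suc j)"
  have mn: "m > 0" "n > 0" by (auto simp: m_def n_def)
  define q where "q = m * m + n * n"
  have q: "q > 0" using mn by (auto simp: q_def intro: add_pos_pos)
  have qq: "qf (i, j) = of_int q" by (simp add: qf_def q_def m_def n_def power2_eq_square)
  have aa: "af (i, j) = of_int (4 * m * m * n * n)"
    by (simp add: af_def m_def n_def power2_eq_square)
  have "f = of_int (10^9 * (72 * q * q - 336 * m * m * n * n)) / of_int (q ^ 8)"
    unfolding f_def qq aa using q by (simp add: dP6_1 field_simps eval_nat_numeral)
  from div_bounds[OF _ this] q
  show "of_int (fl6 (int (Suc i)) (int (Suc j))) \<le> f" "f \<le> of_int (fl6 (int (Suc i)) (int (Suc j))) + 1"
    unfolding fl6_def Let_def m_def[symmetric] n_def[symmetric] q_def[symmetric] by auto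
qed

lemma dH3_1_bounds: "- (695072 / 1000000) \<le> dH3 1" "dH3 1 \<le> - (694988 / 1000000)"
proof -
  let ?f = "\<lambda>i. dP3 (qf i) (af i) 1"
  have s: "?f summable_on UNIV"
    by (rule infsum_dominated(1)[OF abs_dP3_le[OF qf_af_conditions order_refl]]) simp
  \<comment> \<open>The factor \<open>18 - 24 * w\<close> ranges over [-6, 18] for \<open>w\<close>
    in [0, 1].\<close>
  have b: "-6 * (1 / qf i ^ 3) \<le> ?f i" "?f i \<le> 18 * (1 / qf i ^ 3)" for i
    unfolding dP3_1[OF qf_pos]
    by (rule mult_right_mono, use af_qf_frac[of i] in linarith, use qf_pos[of i] in simp)+
  have "sum ?f (grid 25) + -6 * (4 / (3 * real 25 ^ 4)) \<le> dH3 1"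
    "dH3 1 \<le> sum ?f (grid 25) + 18 * (4 / (3 * real 25 ^ 4))"
    unfolding dH3_def by (rule infsum_grid_bounds[OF s _ _ _ b]; simp)+
  moreover have "of_int (-695050748) \<le> 10^9 * sum ?f (grid 25)"
     "10^9 * sum ?f (grid 25) \<le> of_int (-695050748) + real 25 * real 25"
    by (rule grid_sum_bounds[OF dP3_fl3 fl3_sum])+
  ultimately show "- (695072 / 1000000) \<le> dH3 1" "dH3 1 \<le> - (694988 / 1000000)" by simp_all
qed

lemma dH6_1_bounds: "- (185123 / 1000000) \<le> dH6 1" "dH6 1 \<le> - (18512 / 100000)"
proof -
  let ?f = "\<lambda>i. dP6 (qf i) (af i) 1"
  have s: "?f summable_on UNIV"
    by (rule infsum_dominated(1)[OF abs_dP6_le[OF qf_af_conditions order_refl]]) simp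
  \<comment> \<open>Off the grid \<open>q >= 36\<close>, so three of the six powers yield the factor
    1 / 36^3 = 1 / 46656 and the cubic tail bound can be reused.\<close>
  have c: "1 / qf i ^ 6 \<le> 1 / 46656 * (1 / qf i ^ 3)" if "i \<notin> grid 6" for i
  proof -
    have "36 \<le> (real (Suc (fst i)))\<^sup>2 \<or> 36 \<le> (real (Suc (snd i)))\<^sup>2"
    proof -
      have "6 \<le> Suc (fst i) \<or> 6 \<le> Suc (snd i)"
        using that unfolding grid_def by (cases i) auto
      hence "6 \<le> real (Suc (fst i)) \<or> 6 \<le> real (Suc (snd i))" by linarith
      thus ?thesis
        using power_mono[of 6 "real (Suc (fst i))" 2] power_mono[of 6 "real (Suc (snd i))" 2] by auto
    qed
    hence "36 \<le> qf i" unfolding qf_def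
      using zero_le_power2[of "real (Suc (fst i))"] zero_le_power2[of "real (Suc (snd i))"] by linarith
    hence "36 ^ 3 \<le> qf i ^ 3" by (intro power_mono) auto
    hence "46656 * qf i ^ 3 \<le> qf i ^ 3 * qf i ^ 3"
      using qf_pos[of i] by (intro mult_right_mono) auto
    hence "1 / (qf i ^ 3 * qf i ^ 3) \<le> 1 / (46656 * qf i ^ 3)"
      using qf_pos[of i] by (intro divide_left_mono) auto
    thus ?thesis by (simp add: power_add[symmetric])
  qed
  have b: "-12 * (1 / qf i ^ 6) \<le> ?f i" "?f i \<le> 72 * (1 / qf i ^ 6)" for i
    unfolding dP6_1[OF qf_pos]
    by (rule mult_right_mono, use af_qf_frac[of i] in linarith, use qf_pos[of i] in simp)+
  have b': "-12 / 46656 * (1 / qf i ^ 3) \<le> ?f i" "?f i \<le> 72 / 46656 * (1 / qf i ^ 3)" if "i \<notin> grid 6"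
    for i
    using b[of i] c[OF that] by linarith+
  have "sum ?f (grid 6) + -12 / 46656 * (4 / (3 * real 6 ^ 4)) \<le> dH6 1"
    "dH6 1 \<le> sum ?f (grid 6) + 72 / 46656 * (4 / (3 * real 6 ^ 4))"
    unfolding dH6_def by (rule infsum_grid_bounds[OF s _ _ _ b']; simp)+
  moreover have "of_int (-185122216) \<le> 10^9 * sum ?f (grid 6)"
     "10^9 * sum ?f (grid 6) \<le> of_int (-185122216) + real 6 * real 6"
    by (rule grid_sum_bounds[OF dP6_fl6 fl6_sum])+
  ultimately show "- (185123 / 1000000) \<le> dH6 1" "dH6 1 \<le> - (18512 / 100000)" by simp_all
qed

section \<open>Enclosures for zeta values and quadrant sums\<close>

lemma zeta_nat_6_bounds: "(10173428 / 10000000) \<le> zeta_nat 6" "zeta_nat 6 \<le> (10173433 / 10000000)"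
  using zeta_nat_bounds[of 16 5] by (auto simp: eval_nat_numeral)

lemma zeta_nat_12_bounds: "(10002460 / 10000000) \<le> zeta_nat 12" "zeta_nat 12 \<le> (10002461 / 10000000)"
  using zeta_nat_bounds[of 5 11] by (auto simp: eval_nat_numeral)

lemma zeta_nat_3_le: "zeta_nat 3 \<le> (1206 / 1000)"
  using zeta_nat_bounds(2)[of 12 2] by (auto simp: eval_nat_numeral)

lemma S3_le: "S3 \<le> (1819 / 10000)"
proof -
  have "0 \<le> zeta_nat 3" using zeta_nat_bounds(1)[of 1 2] by (simp add: eval_nat_numeral)
  hence "(zeta_nat 3)\<^sup>2 \<le> (1206 / 1000)\<^sup>2" using zeta_nat_3_le by (intro power_mono)
  thus ?thesis using inverse_qf_power(2)[of 3] by (simp add: power2_eq_square)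
qed

lemma S6_le: "S6 \<le> (163 / 10000)"
proof -
  have "(zeta_nat 6)\<^sup>2 \<le> (10173433 / 10000000)\<^sup>2"
    using zeta_nat_6_bounds by (intro power_mono) auto
  thus ?thesis using inverse_qf_power(2)[of 6] by (simp add: power2_eq_square)
qed

section \<open>Monotonicity of the derivative quotient and the minimizer\<close>

definition dG3 where "dG3 u = 4 * zeta_nat 6 * (12 * u\<^sup>2 - 3) + 2 * dH3 u"
definition ddG3 where "ddG3 u = 4 * zeta_nat 6 * (24 * u) + 2 * ddH3 u"
definition dG6 where "dG6 u = 4 * zeta_nat 12 * (192 * u^5 - 192 * u^3 + 36 * u) + 2 * dH6 u"
definition ddG6 where "ddG6 u = 4 * zeta_nat 12 * (960 * u^4 - 576 * u\<^sup>2 + 36) + 2 * ddH6 u"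

context
  fixes u :: real assumes u: "1 \<le> u"
begin

lemma G3_deriv: "(G3 has_real_derivative dG3 u) (at u within {1..})"
  unfolding G3_def[abs_def] dG3_def
  by (rule derivative_eq_intros H3_deriv[OF u] refl | (simp add: algebra_simps; fail))+

lemma dG3_deriv: "(dG3 has_real_derivative ddG3 u) (at u within {1..})"
  unfolding dG3_def[abs_def] ddG3_def
  by (rule derivative_eq_intros dH3_deriv[OF u] refl | (simp add: algebra_simps; fail))+

lemma G6_deriv: "(G6 has_real_derivative dG6 u) (at u within {1..})"
  unfolding G6_def[abs_def] dG6_def
  by (rule derivative_eq_intros H6_deriv[OF u] refl | (simp add: algebra_simps; fail))+

lemma dG6_deriv: "(dG6 has_real_derivative ddG6 u) (at u within {1..})"
  unfolding dG6_def[abs_def] ddG6_def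
  by (rule derivative_eq_intros dH6_deriv[OF u] refl | (simp add: algebra_simps; fail))+

lemma dG3_ge: "40 * u\<^sup>2 - 19 \<le> dG3 u"
proof -
  have u2: "1 \<le> u\<^sup>2" using u by simp
  define T where "T = 4 * zeta_nat 6 * (12 * u\<^sup>2 - 3)"
  have "(4069 / 1000) * (12 * u\<^sup>2 - 3) \<le> T"
    unfolding T_def using zeta_nat_6_bounds u2 by (intro mult_right_mono) auto
  moreover have "\<bar>dH3 u\<bar> \<le> (24 * u\<^sup>2 + 18) * (1819 / 10000)"
    using S3_le by (intro order_trans[OF abs_dH3_le[OF u]] mult_left_mono) auto
  ultimately show ?thesis using u2 unfolding dG3_def T_def[symmetric] unfolding ring_distribs by linarith
qed

lemma dG3_pos: "0 < dG3 u"
proof -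
  have "1 \<le> u\<^sup>2" using u by simp
  thus ?thesis using dG3_ge by linarith
qed

lemma ddG3_le: "ddG3 u \<le> 133 * u + 27"
proof -
  define T where "T = 4 * zeta_nat 6 * (24 * u)"
  have "T \<le> (40694 / 10000) * (24 * u)"
    unfolding T_def using zeta_nat_6_bounds u by (intro mult_right_mono) auto
  moreover have "72 / u \<le> 72" using u by (simp add: divide_simps)
  hence "\<bar>ddH3 u\<bar> \<le> (96 * u + 72) * (1819 / 10000)"
    using S3_le u by (intro order_trans[OF abs_ddH3_le[OF u]] mult_mono)
      (auto intro!: infsum_nonneg simp: qf_pos less_imp_le)
  ultimately show ?thesis using u unfolding ddG3_def T_def[symmetric] unfolding ring_distribs by linarith
qed

lemma ddG6_ge: "3789 * u^4 - 2342 * u\<^sup>2 + 141 \<le> ddG6 u"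
proof -
  have u4: "1 \<le> u\<^sup>2" "u\<^sup>2 \<le> u^4" using u by (auto intro: power_increasing)
  define T where "T = 4 * zeta_nat 12 * (960 * u^4 - 576 * u\<^sup>2 + 36)"
  have "4 * (960 * u^4 - 576 * u\<^sup>2 + 36) \<le> T"
    unfolding T_def using zeta_nat_12_bounds u4 by (intro mult_right_mono) auto
  moreover have "- ddH6 u \<le> (1536 * u^4 + 1152 * u\<^sup>2 + 84) * (163 / 10000)"
  proof -
    have "(1536 * u^4 + 1152 * u\<^sup>2 + 84) * S6
        \<le> (1536 * u^4 + 1152 * u\<^sup>2 + 84) * (163 / 10000)"
      using S6_le by (intro mult_left_mono) auto
    thus ?thesis using ddH6_ge[OF u] unfolding mult_minus_left by linarith
  qed
  ultimately show ?thesis using u4 unfolding ddG6_def T_def[symmetric] unfolding ring_distribs by linarith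
qed

lemma dG6_bounds: "0 \<le> dG6 u" "dG6 u \<le> 781 * u^5 - 758 * u^3 + 145 * u + 1"
proof -
  have u5: "u^3 \<le> u^5" "u \<le> u^3"
    using u power_increasing[of 1 3 u] by (auto intro: power_increasing)
  define T where "T = 4 * zeta_nat 12 * (192 * u^5 - 192 * u^3 + 36 * u)"
  have "4 * (192 * u^5 - 192 * u^3 + 36 * u) \<le> T"
    unfolding T_def using zeta_nat_12_bounds u5 u by (intro mult_right_mono) auto
  moreover have "T \<le> (4001 / 1000) * (192 * u^5 - 192 * u^3 + 36 * u)"
    unfolding T_def using zeta_nat_12_bounds u5 u by (intro mult_right_mono) auto
  moreover have "\<bar>dH6 u\<bar> \<le> (384 * u^5 + 288 * u^3 + 12) * (163 / 10000)"
    using S6_le u by (intro order_trans[OF abs_dH6_le[OF u]] mult_left_mono) auto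
  \<comment> \<open>Up to rounding this is twice the lower bound for \<open>dG6 u\<close>; expanded
    in \<open>v = u - 1\<close> it has only nonnegative coefficients.\<close>
  moreover have "0 \<le> 1511 * u^5 - 1556 * u^3 + 280 * u - 1"
  proof -
    define v where "v = u - 1"
    have v: "0 \<le> v" "u = 1 + v" using u by (auto simp: v_def)
    show ?thesis unfolding v(2) using v(1) by (simp add: algebra_simps eval_nat_numeral)
  qed
  ultimately show "0 \<le> dG6 u" "dG6 u \<le> 781 * u^5 - 758 * u^3 + 145 * u + 1"
    using u u5 unfolding dG6_def T_def[symmetric] unfolding ring_distribs by linarith+
qed

text \<open>Inserting the bounds above leaves a polynomial in \<open>u\<close> all of whose Taylor coefficients at
  \<open>u = 1\<close> are positive.\<close>

lemma wronskian_pos: "0 < ddG6 u * dG3 u - dG6 u * ddG3 u"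
proof -
  have u2: "1 \<le> u\<^sup>2" using u by simp
  have u4: "u\<^sup>2 \<le> u^4" using u by (auto intro: power_increasing)
  \<comment> \<open>Nonnegativity of \<open>dG6\<close> allows the upper bound for
    \<open>ddG3\<close> to be inserted without knowing the sign of \<open>ddG3\<close>.\<close>
  have "dG6 u * ddG3 u \<le> dG6 u * (133 * u + 27)"
    by (intro mult_left_mono ddG3_le dG6_bounds)
  also have "\<dots> \<le> (781 * u^5 - 758 * u^3 + 145 * u + 1) * (133 * u + 27)"
    using u by (intro mult_right_mono dG6_bounds) auto
  also have "\<dots> < (3789 * u^4 - 2342 * u\<^sup>2 + 141) * (40 * u\<^sup>2 - 19)"
  proof -
    define v where "v = u - 1"
    have v: "0 \<le> v" "u = 1 + v" using u by (auto simp: v_def)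
    have "0 < 6308 + 40315 * v^1 + 207544 * v^2 + 503908 * v^3 + 545013 * v^4 + 265035 * v^5 + 47687 * v^6"
      using v(1) by (intro add_pos_nonneg) auto
    also have "\<dots> = (3789 * u^4 - 2342 * u\<^sup>2 + 141) * (40 * u\<^sup>2 - 19)
        - (781 * u^5 - 758 * u^3 + 145 * u + 1) * (133 * u + 27)"
      unfolding v(2) by (simp add: algebra_simps eval_nat_numeral)
    finally show ?thesis by simp
  qed
  also have "\<dots> \<le> ddG6 u * dG3 u"
  proof (intro mult_mono ddG6_ge dG3_ge)
    show "0 \<le> ddG6 u" using ddG6_ge u2 u4 by linarith
    show "0 \<le> 40 * u\<^sup>2 - 19" using u2 by linarith
  qed
  finally show ?thesis by simp
qed

end

section \<open>Strict monotonicity of the derivative quotient and the shape of the objective\<close>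

definition deriv_ratio :: "real \<Rightarrow> real" where "deriv_ratio u = dG6 u / dG3 u"

lemma deriv_ratio_deriv:
  assumes "1 \<le> u"
  shows "(deriv_ratio has_real_derivative (ddG6 u * dG3 u - dG6 u * ddG3 u) / (dG3 u * dG3 u)) (at u within {1..})"
  unfolding deriv_ratio_def[abs_def] using dG3_pos[OF assms]
  by (intro DERIV_divide dG6_deriv dG3_deriv assms) simp

lemma at_within_atLeast_interior: "1 < u \<Longrightarrow> at u within {1::real..} = at u"
  by (rule at_within_interior) simp

lemma deriv_ratio_deriv_pos:
  assumes "1 < u"
  obtains D where "0 < D" "(deriv_ratio has_real_derivative D) (at u)"
proof (rule that)
  show "0 < (ddG6 u * dG3 u - dG6 u * ddG3 u) / (dG3 u * dG3 u)"
    using wronskian_pos[of u] dG3_pos[of u] assms by (intro divide_pos_pos mult_pos_pos) auto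
  show "(deriv_ratio has_real_derivative (ddG6 u * dG3 u - dG6 u * ddG3 u) / (dG3 u * dG3 u)) (at u)"
    using deriv_ratio_deriv[of u] assms by (simp add: at_within_atLeast_interior)
qed

lemma deriv_ratio_cont: "continuous_on {1..} deriv_ratio"
  by (rule DERIV_continuous_on[OF deriv_ratio_deriv]) auto

lemma deriv_ratio_strict_mono:
  assumes "1 \<le> a" "a < b"
  shows "deriv_ratio a < deriv_ratio b"
proof (rule DERIV_pos_imp_increasing_open[OF assms(2)])
  fix x assume "a < x" "x < b"
  then obtain D where "0 < D" "(deriv_ratio has_real_derivative D) (at x)"
    using assms deriv_ratio_deriv_pos[of x] by auto
  thus "\<exists>D. (deriv_ratio has_real_derivative D) (at x) \<and> 0 < D" by blast
qed (rule continuous_on_subset[OF deriv_ratio_cont], use assms in auto)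

lemma deriv_ratio_less_iff: "1 \<le> a \<Longrightarrow> 1
    \<le> b \<Longrightarrow> deriv_ratio a < deriv_ratio b \<longleftrightarrow> a < b"
  using deriv_ratio_strict_mono[of a b] deriv_ratio_strict_mono[of b a] by (cases a b rule: linorder_cases) auto

text \<open>The coefficients 36 and 144 are 4 * 3^2 and 4 * 6^2, because \<open>T_k\<close> has
  slope \<open>k^2\<close> at 1. Cross-multiplied, the claim is linear in the four enclosed
  constants.\<close>

lemma deriv_ratio_1_bounds: "(40774 / 10000) \<le> deriv_ratio 1" "deriv_ratio 1 < (40775 / 10000)"
proof -
  have "dG3 1 = 36 * zeta_nat 6 + 2 * dH3 1" "dG6 1 = 144 * zeta_nat 12 + 2 * dH6 1"
    by (simp_all add: dG3_def dG6_def)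
  hence "(40774 / 10000) * dG3 1 \<le> dG6 1" "dG6 1 < (40775 / 10000) * dG3 1"
    using zeta_nat_6_bounds zeta_nat_12_bounds dH3_1_bounds dH6_1_bounds by linarith+
  thus "(40774 / 10000) \<le> deriv_ratio 1" "deriv_ratio 1 < (40775 / 10000)"
    unfolding deriv_ratio_def using dG3_pos[of 1] by (simp_all add: pos_le_divide_eq pos_divide_less_eq)
qed

lemma objective_deriv:
  assumes "1 \<le> u"
  shows "((\<lambda>u. G6 u - b * G3 u) has_real_derivative dG3 u * (deriv_ratio u - b)) (at u within {1..})"
proof -
  have "dG3 u * (deriv_ratio u - b) = dG6 u - b * dG3 u"
    using dG3_pos[OF assms] by (simp add: deriv_ratio_def right_diff_distrib)
  thus ?thesis using G6_deriv[OF assms] G3_deriv[OF assms]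
    by (auto intro!: derivative_eq_intros)
qed

lemma objective_cont: "1 \<le> a \<Longrightarrow> continuous_on {a..c} (\<lambda>u. G6 u - b * G3 u)"
  by (rule continuous_on_subset[OF DERIV_continuous_on[OF objective_deriv]]) auto

text \<open>Weak inequalities on the two sides of \<open>w\<close> cover both regimes: for
  \<open>w = 1\<close> the condition below is vacuous, and otherwise \<open>w\<close> is the
  interior critical point.\<close>

lemma objective_min:
  assumes w: "1 \<le> w" and below: "\<And>x. 1 < x \<Longrightarrow> x < w \<Longrightarrow> deriv_ratio x \<le> b"
    and above: "\<And>x. w < x \<Longrightarrow> b \<le> deriv_ratio x" and u: "1 \<le> u"
  shows "G6 w - b * G3 w \<le> G6 u - b * G3 u"
proof (cases "w \<le> u")
  case True
  thus ?thesis
  proof (rule DERIV_nonneg_imp_increasing_open[where f = "\<lambda>u. G6 u - b * G3 u"])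
    fix x assume x: "w < x" "x < u"
    have "0 \<le> dG3 x * (deriv_ratio x - b)" using above[OF x(1)] dG3_pos[of x] w x by simp
    thus "\<exists>D. ((\<lambda>u. G6 u - b * G3 u) has_real_derivative D) (at x) \<and> 0 \<le> D"
      using objective_deriv[of x b] w x by (auto simp: at_within_atLeast_interior)
  qed (rule objective_cont[OF w])
next
  case False
  hence "u \<le> w" by simp
  thus ?thesis
  proof (rule DERIV_nonpos_imp_decreasing_open[where f = "\<lambda>u. G6 u - b * G3 u"])
    fix x assume x: "u < x" "x < w"
    have "dG3 x * (deriv_ratio x - b) \<le> 0"
      using below[of x] dG3_pos[of x] u x by (simp add: mult_nonneg_nonpos)
    thus "\<exists>D. ((\<lambda>u. G6 u - b * G3 u) has_real_derivative D) (at x) \<and> D \<le> 0"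
      using objective_deriv[of x b] u x by (auto simp: at_within_atLeast_interior)
  qed (rule objective_cont[OF u])
qed

section \<open>The substitution from \<open>y\<close> to \<open>u\<close> and the value of
  \<open>b_a\<close>\<close>

lemma u_of_y_ge: "y > 0 \<Longrightarrow> 1 \<le> u_of_y y"
  using sum_squares_bound[of y 1] by (simp add: u_of_y_def field_simps power2_eq_square)

lemma u_of_y_gt:
  assumes "y > 0" "y \<noteq> 1" shows "1 < u_of_y y"
proof -
  have "0 < (y - 1)\<^sup>2" using assms by simp
  thus ?thesis using assms by (simp add: u_of_y_def field_simps power2_eq_square)
qed

lemma u_of_y_deriv: "y > 0 \<Longrightarrow> (u_of_y has_real_derivative (1 - 1 / y\<^sup>2) / 2) (at y)"
  unfolding u_of_y_def[abs_def] by (auto intro!: derivative_eq_intros simp: field_simps power2_eq_square)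

text \<open>For \<open>y\<close> different from 1 the point \<open>u_of_y y\<close> is interior to
  [1, oo), so the one-sided derivative is a full one. The factor \<open>(1 - 1 / y^2) / 2\<close> is
  the same for both zeta functions and cancels in their quotient.\<close>

lemma deriv_comp_u_of_y:
  assumes F: "\<And>t. 0 < t \<Longrightarrow> F t = g (u_of_y t)" and g: "(g has_real_derivative D) (at (u_of_y y) within {1..})"
    and y: "y > 0" "y \<noteq> 1"
  shows "deriv F y = D * ((1 - 1 / y\<^sup>2) / 2)"
proof (rule DERIV_imp_deriv)
  have "((\<lambda>t. g (u_of_y t)) has_real_derivative D * ((1 - 1 / y\<^sup>2) / 2)) (at y)"
    using g u_of_y_gt[OF y] by (intro DERIV_chain2[OF _ u_of_y_deriv[OF y(1)]]) (simp add: at_within_atLeast_interior)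
  thus "(F has_real_derivative D * ((1 - 1 / y\<^sup>2) / 2)) (at y)"
    by (rule has_field_derivative_transform_within_open[of _ _ _ "{0<..}"]) (use y F in auto)
qed

lemma deriv_quotient:
  assumes "y > 0" "y \<noteq> 1"
  shows "deriv (\<lambda>t. epstein_zeta 6 (\<i> * of_real t)) y / deriv (\<lambda>t. epstein_zeta 3 (\<i> * of_real t)) y
    = deriv_ratio (u_of_y y)"
proof -
  define c where "c = (1 - 1 / y\<^sup>2) / 2"
  have "c \<noteq> 0" using assms by (simp add: c_def power2_eq_1_iff)
  moreover have "deriv (\<lambda>t. epstein_zeta 6 (\<i> * of_real t)) y = dG6 (u_of_y y) * c"
    unfolding c_def using assms by (intro deriv_comp_u_of_y[where g = G6] G6_deriv u_of_y_ge epstein_zeta_6)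
  moreover have "deriv (\<lambda>t. epstein_zeta 3 (\<i> * of_real t)) y = dG3 (u_of_y y) * c"
    unfolding c_def using assms by (intro deriv_comp_u_of_y[where g = G3] G3_deriv u_of_y_ge epstein_zeta_3)
  ultimately show ?thesis by (simp add: deriv_ratio_def)
qed

lemma quotient_tendsto:
  "((\<lambda>y. deriv (\<lambda>t. epstein_zeta 6 (\<i> * of_real t)) y / deriv (\<lambda>t. epstein_zeta 3 (\<i> * of_real t)) y)
     \<longlongrightarrow> deriv_ratio 1) (at 1)"
proof -
  have "continuous_on {0<..} (\<lambda>y. deriv_ratio (u_of_y y))"
    by (rule continuous_on_compose2[OF deriv_ratio_cont DERIV_continuous_on[OF has_field_derivative_at_within[OF u_of_y_deriv]]])
       (auto intro: u_of_y_ge)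
  hence "isCont (\<lambda>y. deriv_ratio (u_of_y y)) 1"
    by (simp add: continuous_on_eq_continuous_at)
  hence "((\<lambda>y. deriv_ratio (u_of_y y)) \<longlongrightarrow> deriv_ratio 1) (at 1)"
    by (simp add: isCont_def u_of_y_def)
  moreover have "eventually (\<lambda>y::real. y \<in> {0<..} - {1}) (at 1)"
    by (rule eventually_at_in_open) auto
  hence "eventually (\<lambda>y. deriv_ratio (u_of_y y)
      = deriv (\<lambda>t. epstein_zeta 6 (\<i> * of_real t)) y
      / deriv (\<lambda>t. epstein_zeta 3 (\<i> * of_real t)) y) (at 1)"
    by eventually_elim (use deriv_quotient in auto)
  ultimately show ?thesis by (rule Lim_transform_eventually)
qed

lemma b_a_eq: "b_a = deriv_ratio 1"
  unfolding b_a_def by (rule tendsto_Lim[OF _ quotient_tendsto]) simp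

section \<open>Growth of the derivative quotient at infinity\<close>

lemma dG3_asymp: "((\<lambda>u. dG3 u / u\<^sup>2) \<longlongrightarrow> 48 * zeta_nat 6) at_top"
proof -
  have "((\<lambda>u. dH3 u / u\<^sup>2) \<longlongrightarrow> 0) at_top"
  proof (rule Lim_null_comparison)
    show "eventually (\<lambda>u. norm (dH3 u / u\<^sup>2) \<le> 30 * S2 / u) at_top"
      using eventually_ge_at_top[of 1]
    proof eventually_elim
      case (elim u)
      have "\<bar>dH3 u\<bar> / u\<^sup>2 \<le> 30 * u * S2 / u\<^sup>2"
        by (intro divide_right_mono abs_dH3_le_linear elim) simp
      thus ?case using elim by (simp add: power2_eq_square)
    qed
    have "((\<lambda>u. c / u) \<longlongrightarrow> 0) at_top" for c :: real by real_asymp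
    thus "((\<lambda>u. 30 * S2 / u) \<longlongrightarrow> 0) at_top" .
  qed
  moreover have "((\<lambda>u. 4 * zeta_nat 6 * (12 * u\<^sup>2 - 3) / u\<^sup>2) \<longlongrightarrow> 4 * zeta_nat 6 * 12) at_top"
  proof -
    have "((\<lambda>u::real. (12 * u\<^sup>2 - 3) / u\<^sup>2) \<longlongrightarrow> 12) at_top"
      by real_asymp
    from tendsto_mult_left[OF this, of "4 * zeta_nat 6"] show ?thesis by simp
  qed
  ultimately have "((\<lambda>u. 4 * zeta_nat 6 * (12 * u\<^sup>2 - 3) / u\<^sup>2 + 2 * (dH3 u / u\<^sup>2)) \<longlongrightarrow> 4 * zeta_nat 6 * 12 + 2 * 0) at_top"
    by (intro tendsto_add tendsto_mult_left)
  thus ?thesis by (simp add: dG3_def add_divide_distrib)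
qed

lemma dG6_asymp: "((\<lambda>u. dG6 u / u^5) \<longlongrightarrow> 768 * zeta_nat 12) at_top"
proof -
  have "((\<lambda>u. dH6 u / u^5) \<longlongrightarrow> 0) at_top"
  proof (rule Lim_null_comparison)
    show "eventually (\<lambda>u. norm (dH6 u / u^5) \<le> 492 * S2 / u) at_top"
      using eventually_ge_at_top[of 1]
    proof eventually_elim
      case (elim u)
      have "\<bar>dH6 u\<bar> / u^5 \<le> 492 * u^4 * S2 / u^5"
        using elim by (intro divide_right_mono abs_dH6_le_power4) simp_all
      thus ?case using elim by (simp add: eval_nat_numeral)
    qed
    have "((\<lambda>u. c / u) \<longlongrightarrow> 0) at_top" for c :: real by real_asymp
    thus "((\<lambda>u. 492 * S2 / u) \<longlongrightarrow> 0) at_top" .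
  qed
  moreover have "((\<lambda>u. 4 * zeta_nat 12 * (192 * u^5 - 192 * u^3 + 36 * u) / u^5) \<longlongrightarrow> 4 * zeta_nat 12 * 192) at_top"
  proof -
    have "((\<lambda>u::real. (192 * u^5 - 192 * u^3 + 36 * u) / u^5) \<longlongrightarrow> 192) at_top"
      by real_asymp
    from tendsto_mult_left[OF this, of "4 * zeta_nat 12"] show ?thesis by simp
  qed
  ultimately have "((\<lambda>u. 4 * zeta_nat 12 * (192 * u^5 - 192 * u^3 + 36 * u) / u^5 + 2 * (dH6 u / u^5))
      \<longlongrightarrow> 4 * zeta_nat 12 * 192 + 2 * 0) at_top"
    by (intro tendsto_add tendsto_mult_left)
  thus ?thesis by (simp add: dG6_def add_divide_distrib)
qed

lemma deriv_ratio_asymp: "((\<lambda>u. deriv_ratio u / u^3) \<longlongrightarrow> 16 * zeta_nat 12 / zeta_nat 6) at_top"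
proof -
  have "((\<lambda>u. (dG6 u / u^5) / (dG3 u / u\<^sup>2)) \<longlongrightarrow> (768 * zeta_nat 12) / (48 * zeta_nat 6)) at_top"
    using zeta_nat_6_bounds by (intro tendsto_divide dG6_asymp dG3_asymp) auto
  moreover have "eventually (\<lambda>u. (dG6 u / u^5) / (dG3 u / u\<^sup>2) = deriv_ratio u / u^3) at_top"
    using eventually_gt_at_top[of 0] by eventually_elim (simp add: deriv_ratio_def field_simps eval_nat_numeral)
  ultimately show ?thesis by (auto intro: Lim_transform_eventually)
qed

lemma deriv_ratio_at_top: "filterlim deriv_ratio at_top at_top"
proof -
  have lim: "filterlim (\<lambda>u. (deriv_ratio u / u^3) * u^3) at_top at_top"
    using zeta_nat_6_bounds zeta_nat_12_bounds
    by (intro filterlim_tendsto_pos_mult_at_top[OF deriv_ratio_asymp] filterlim_pow_at_top filterlim_ident) auto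
  have "eventually (\<lambda>u. (deriv_ratio u / u^3) * u^3 = deriv_ratio u) at_top"
    using eventually_gt_at_top[of 0] by eventually_elim simp
  from iffD1[OF filterlim_cong[OF refl refl this] lim] show ?thesis .
qed

section \<open>The critical point as a function of \<open>b\<close>\<close>

definition crit_u :: "real \<Rightarrow> real" where "crit_u b = (THE u. 1 \<le> u \<and> deriv_ratio u = b)"

lemma crit_u_deriv_ratio: "1 \<le> u \<Longrightarrow> crit_u (deriv_ratio u) = u"
  unfolding crit_u_def using deriv_ratio_less_iff by (intro the_equality) (auto simp: linorder_neq_iff, metis less_irrefl linorder_neqE)

text \<open>Existence follows from the intermediate value theorem, as \<open>deriv_ratio\<close> is
  unbounded. For \<open>b\<close> below \<open>deriv_ratio 1\<close> the description in
  \<open>crit_u\<close> has no witness, hence the hypothesis.\<close>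

lemma crit_u:
  assumes "deriv_ratio 1 < b"
  shows "deriv_ratio (crit_u b) = b" "1 < crit_u b"
proof -
  have "eventually (\<lambda>u. b \<le> deriv_ratio u \<and> 1 \<le> u) at_top"
    using deriv_ratio_at_top eventually_ge_at_top[of 1] by (auto simp: filterlim_at_top eventually_conj_iff)
  then obtain K where K: "b \<le> deriv_ratio K" "1 \<le> K"
    by (auto simp: eventually_at_top_linorder)
  then obtain u where u: "1 \<le> u" "deriv_ratio u = b"
    using IVT'[of deriv_ratio 1 b K] assms continuous_on_subset[OF deriv_ratio_cont, of "{1..K}"] by auto
  thus "deriv_ratio (crit_u b) = b" "1 < crit_u b"
    using crit_u_deriv_ratio[of u] assms by (auto simp: order.order_iff_strict)
qed

lemma crit_u_deriv:
  assumes "deriv_ratio 1 < b"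
  obtains D where "0 < D" "(crit_u has_real_derivative D) (at b)"
proof -
  obtain D where D: "0 < D" "(deriv_ratio has_real_derivative D) (at (crit_u b))"
    using deriv_ratio_deriv_pos[OF crit_u(2)[OF assms]] .
  have "isCont crit_u (deriv_ratio (crit_u b))"
  \<comment> \<open>The neighbourhood from the midpoint of 1 and \<open>crit_u b\<close> to
    \<open>crit_u b + 1\<close> stays inside (1, oo), where \<open>deriv_ratio\<close> is continuous
    and inverted by \<open>crit_u\<close>.\<close>
  proof (rule isCont_inverse_function2[where f = deriv_ratio and g = crit_u and x = "crit_u b" and a = "(1 + crit_u b) / 2" and b = "crit_u b + 1"])
    show "isCont deriv_ratio z" if "(1 + crit_u b) / 2 \<le> z" "z \<le> crit_u b + 1" for z
      by (rule continuous_on_interior[OF deriv_ratio_cont]) (use that crit_u(2)[OF assms] in auto)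
  qed (use crit_u(2)[OF assms] in \<open>auto intro!: crit_u_deriv_ratio\<close>)
  hence "(crit_u has_real_derivative inverse D) (at b)"
    using D assms by (intro DERIV_inverse_function[where f = deriv_ratio and a = "deriv_ratio 1" and b = "b + 1"]) (auto simp: crit_u)
  thus ?thesis using D that[of "inverse D"] by simp
qed

lemma crit_u_at_top: "filterlim crit_u at_top at_top"
  unfolding filterlim_at_top
proof
  fix K
  show "eventually (\<lambda>b. K \<le> crit_u b) at_top"
    using eventually_gt_at_top[of "deriv_ratio (max 1 K)"]
  proof eventually_elim
    case (elim b)
    have "deriv_ratio 1 \<le> deriv_ratio (max 1 K)"
      using deriv_ratio_strict_mono[of 1 "max 1 K"] by (cases "K \<le> 1") (auto simp: max_def)
    hence b: "deriv_ratio 1 < b" using elim by simp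
    hence "max 1 K < crit_u b"
      using elim crit_u[OF b] deriv_ratio_less_iff[of "max 1 K" "crit_u b"] by simp
    thus ?case by simp
  qed
qed

text \<open>The larger root of \<open>y^2 - 2 * u * y + 1 = 0\<close>, that is, the inverse branch
  of \<open>u_of_y\<close> with values at least 1.\<close>

definition y_of_u :: "real \<Rightarrow> real" where "y_of_u u = u + sqrt (u\<^sup>2 - 1)"

lemma u_of_y_y_of_u:
  assumes "1 \<le> u" shows "u_of_y (y_of_u u) = u"
proof -
  define s where "s = sqrt (u\<^sup>2 - 1)"
  have s: "0 \<le> s" "s\<^sup>2 = u\<^sup>2 - 1" using assms by (auto simp: s_def)
  have "(u + s) * (u - s) = 1" using s by (simp add: algebra_simps power2_eq_square)
  hence "1 / (u + s) = u - s" using s assms by (simp add: field_simps)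
  thus ?thesis by (simp add: u_of_y_def y_of_u_def s_def)
qed

lemma y_of_u_gt: "1 < u \<Longrightarrow> 1 < y_of_u u"
  unfolding y_of_u_def by (rule less_le_trans[of _ u]) auto

lemma y_of_u_deriv:
  assumes "1 < u" shows "(y_of_u has_real_derivative 1 + u / sqrt (u\<^sup>2 - 1)) (at u)"
proof -
  have "0 < u\<^sup>2 - 1" using assms by simp
  thus ?thesis unfolding y_of_u_def[abs_def]
    by (auto intro!: derivative_eq_intros simp: field_simps)
qed

text \<open>Parametrised by \<open>u\<close> with \<open>b = deriv_ratio u\<close>, so that
  composition with \<open>crit_u\<close> gives the limit in \<open>b\<close>. After division by
  \<open>u\<close>, the numerator tends to 2 and the denominator to the cube root of 8.\<close>

lemma y_of_u_asymp:
  "((\<lambda>u. y_of_u u / root 3 (zeta_nat 6 / (2 * zeta_nat 12) * deriv_ratio u)) \<longlongrightarrow> 1) at_top"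
proof -
  have z: "zeta_nat 6 > 0" "zeta_nat 12 > 0" using zeta_nat_6_bounds zeta_nat_12_bounds by auto
  have "root 3 (2 ^ 3) = (2::real)" by (rule real_root_power_cancel) auto
  hence "root 3 8 = (2::real)" by simp
  moreover have "((\<lambda>u. root 3 (zeta_nat 6 / (2 * zeta_nat 12) * (deriv_ratio u / u^3))) \<longlongrightarrow> root 3 (zeta_nat 6 / (2 * zeta_nat 12) * (16 * zeta_nat 12 / zeta_nat 6))) at_top"
    by (intro tendsto_real_root tendsto_mult_left deriv_ratio_asymp)
  ultimately have "((\<lambda>u. root 3 (zeta_nat 6 / (2 * zeta_nat 12) * (deriv_ratio u / u^3))) \<longlongrightarrow> 2) at_top"
    using z by simp
  moreover have "((\<lambda>u. y_of_u u / u) \<longlongrightarrow> 2) at_top"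
    unfolding y_of_u_def by real_asymp
  ultimately have "((\<lambda>u. (y_of_u u / u) / root 3 (zeta_nat 6 / (2 * zeta_nat 12) * (deriv_ratio u / u^3))) \<longlongrightarrow> 2 / 2) at_top"
    by (intro tendsto_divide) auto
  moreover have "eventually (\<lambda>u. (y_of_u u / u) / root 3 (zeta_nat 6 / (2 * zeta_nat 12) * (deriv_ratio u / u^3))
      = y_of_u u / root 3 (zeta_nat 6 / (2 * zeta_nat 12) * deriv_ratio u)) at_top"
    using eventually_gt_at_top[of 0]
  proof eventually_elim
    case (elim u)
    have "root 3 (u ^ 3) = u" using elim by (intro real_root_power_cancel) auto
    thus ?case using elim by (simp add: real_root_mult real_root_divide)
  qed
  ultimately show ?thesis by (auto intro: Lim_transform_eventually)
qed

lemma Gamma_a_epstein: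
  assumes "z \<in> Gamma_a"
  shows "epstein_zeta 6 z = G6 (u_of_y (Im z))" "epstein_zeta 3 z = G3 (u_of_y (Im z))" "1 \<le> u_of_y (Im z)"
proof -
  have z: "z = \<i> * of_real (Im z)" "0 < Im z"
    using assms by (auto simp: Gamma_a_def complex_eq_iff)
  show "epstein_zeta 6 z = G6 (u_of_y (Im z))" "epstein_zeta 3 z = G3 (u_of_y (Im z))"
    using epstein_zeta_6[OF z(2)] epstein_zeta_3[OF z(2)] z(1) by simp_all
  show "1 \<le> u_of_y (Im z)" using u_of_y_ge[OF z(2)] .
qed

theorem theorem6p2:
  shows "((\<lambda>y. deriv (\<lambda>t. epstein_zeta 6 (\<i> * of_real t)) y
              / deriv (\<lambda>t. epstein_zeta 3 (\<i> * of_real t)) y) \<longlongrightarrow> b_a) (at 1)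
    \<and> 4.0774 \<le> b_a \<and> b_a < 4.0775
    \<and> (\<forall>b::real. b \<le> b_a \<longrightarrow>
         \<i> \<in> Gamma_a \<and>
         (\<forall>z\<in>Gamma_a. epstein_zeta 6 \<i> - b * epstein_zeta 3 \<i>
                          \<le> epstein_zeta 6 z - b * epstein_zeta 3 z))
    \<and> (\<exists>yb :: real \<Rightarrow> real.
         (\<forall>b>b_a. yb b > 1 \<and>
            (\<forall>z\<in>Gamma_a. epstein_zeta 6 (\<i> * of_real (yb b)) - b * epstein_zeta 3 (\<i> * of_real (yb b))
                            \<le> epstein_zeta 6 z - b * epstein_zeta 3 z))
       \<and> (\<forall>b>b_a. \<exists>D>0. (yb has_real_derivative D) (at b))
       \<and> ((\<lambda>b. yb b / root 3 (riemann_zeta_real 6 / (2 * riemann_zeta_real 12) * b))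
             \<longlongrightarrow> 1) at_top)"
\<comment> \<open>The witness sends \<open>b\<close> to the critical \<open>u\<close> and then back
  to the half-line \<open>y >= 1\<close>.\<close>
proof (intro conjI allI impI ballI exI[of _ "\<lambda>b. y_of_u (crit_u b)"])
  show "((\<lambda>y. deriv (\<lambda>t. epstein_zeta 6 (\<i> * of_real t)) y
      / deriv (\<lambda>t. epstein_zeta 3 (\<i> * of_real t)) y) \<longlongrightarrow> b_a) (at 1)"
    unfolding b_a_eq by (rule quotient_tendsto)
  show "4.0774 \<le> b_a" "b_a < 4.0775" unfolding b_a_eq using deriv_ratio_1_bounds by simp_all
  show i: "\<i> \<in> Gamma_a" by (simp add: Gamma_a_def)
  show "epstein_zeta 6 \<i> - b * epstein_zeta 3 \<i> \<le> epstein_zeta 6 z - b * epstein_zeta 3 z"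
    if "b \<le> b_a" "z \<in> Gamma_a" for b z
  proof -
    have "b \<le> deriv_ratio x" if "1 < x" for x using deriv_ratio_strict_mono[of 1 x] that \<open>b \<le> b_a\<close> by (simp add: b_a_eq)
    from objective_min[of 1 b, OF _ _ this Gamma_a_epstein(3)[OF that(2)]] show ?thesis
      by (simp add: Gamma_a_epstein[OF i] Gamma_a_epstein[OF that(2)] u_of_y_def)
  qed
  fix b assume "b_a < b"
  hence b: "deriv_ratio 1 < b" by (simp add: b_a_eq)
  note ubb = crit_u[OF b]
  show y: "1 < y_of_u (crit_u b)" by (rule y_of_u_gt[OF ubb(2)])
  show "epstein_zeta 6 (\<i> * of_real (y_of_u (crit_u b))) - b * epstein_zeta 3 (\<i> * of_real (y_of_u (crit_u b)))
      \<le> epstein_zeta 6 z - b * epstein_zeta 3 z" if "z \<in> Gamma_a" for z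
  proof -
    have "deriv_ratio x \<le> b" if "1 < x" "x < crit_u b" for x
      using deriv_ratio_strict_mono[of x "crit_u b"] that ubb by simp
    moreover have "b \<le> deriv_ratio x" if "crit_u b < x" for x
      using deriv_ratio_strict_mono[of "crit_u b" x] that ubb by simp
    ultimately show ?thesis
      using objective_min[of "crit_u b" b "u_of_y (Im z)"] ubb y Gamma_a_epstein[OF that]
      by (simp add: epstein_zeta_6 epstein_zeta_3 u_of_y_y_of_u)
  qed
  obtain D where D: "0 < D" "(crit_u has_real_derivative D) (at b)" using crit_u_deriv[OF b] .
  have "((\<lambda>b. y_of_u (crit_u b)) has_real_derivative (1 + crit_u b / sqrt ((crit_u b)\<^sup>2 - 1)) * D) (at b)"
    by (rule DERIV_chain2[OF y_of_u_deriv[OF ubb(2)] D(2)])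
  moreover have "0 < (1 + crit_u b / sqrt ((crit_u b)\<^sup>2 - 1)) * D"
    \<comment> \<open>Both factors are positive: \<open>y_of_u\<close> and \<open>crit_u\<close> are
      increasing, so their composition is too.\<close>
    using D ubb by (intro mult_pos_pos add_pos_nonneg) auto
  ultimately show "\<exists>D>0. ((\<lambda>b. y_of_u (crit_u b)) has_real_derivative D) (at b)"
    by blast
next
  have "((\<lambda>b. y_of_u (crit_u b) / root 3 (zeta_nat 6 / (2 * zeta_nat 12) * deriv_ratio (crit_u b))) \<longlongrightarrow> 1) at_top"
    by (rule filterlim_compose[OF y_of_u_asymp crit_u_at_top])
  moreover have "eventually (\<lambda>b. y_of_u (crit_u b) / root 3 (zeta_nat 6 / (2 * zeta_nat 12) * deriv_ratio (crit_u b))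
      = y_of_u (crit_u b) / root 3 (riemann_zeta_real 6 / (2 * riemann_zeta_real 12) * b)) at_top"
    using eventually_gt_at_top[of "deriv_ratio 1"] by eventually_elim (simp add: crit_u riemann_zeta_real_eq)
  ultimately show "((\<lambda>b. y_of_u (crit_u b) / root 3 (riemann_zeta_real 6 / (2 * riemann_zeta_real 12) * b))
      \<longlongrightarrow> 1) at_top"
    by (rule Lim_transform_eventually)
qed

end
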